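(* Let $\mathcal{A}$ be the M2-brane algebra described in the context, with coproduct $Y(w)=\Delta_{\mathcal{A}}:\mathcal{A}\to(\mathcal{A}\otimes\mathcal{A})(\!(w^{-1})\!)$ and augmentation $c:\mathcal{A}\to\mathbb{C}$ (the algebra homomorphism with $c(1)=1$ and $c(t_{a,b})=0$ for all $a,b\ge 0$). Then $(\mathcal{A},Y(w),c)$ is a vertex coalgebra, i.e. the following hold for all $v\in\mathcal{A}$: (1) (left counit) $(c\otimes \mathrm{Id})Y(w)v=v$; (2) (cocreation) $(\mathrm{Id}\otimes c)Y(w)v\in\mathcal{A}[w]$ and $\lim_{w\to 0}(\mathrm{Id}\otimes c)Y(w)v=v$; (3) (Jacobi identity) $$w_0^{-1}\delta\!\left(\tfrac{w_1-w_2}{w_0}\right)(\mathrm{Id}\otimes Y(w_2))Y(w_1)v-w_0^{-1}\delta\!\left(\tfrac{w_2-w_1}{-w_0}\right)(T\otimes\mathrm{Id})(\mathrm{Id}\otimes Y(w_1))Y(w_2)v=w_2^{-1}\delta\!\left(\tfrac{w_1-w_0}{w_2}\right)(Y(w_0)\otimes\mathrm{Id})Y(w_2)v.$$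
   Context: Fix complex parameters $\epsilon_1,\epsilon_2,\epsilon_3$ with $\epsilon_1+\epsilon_2+\epsilon_3=0$, and set $\sigma_2=\epsilon_1^2+\epsilon_1\epsilon_2+\epsilon_2^2$, $\sigma_3=\epsilon_1\epsilon_2\epsilon_3$. $\mathcal{A}$ is the associative $\mathbb{C}$-algebra $U_{\epsilon_1}(\mathfrak{gl}_1\otimes\mathrm{Diff}_{\epsilon_2}(\mathbb{C}))$ (the large-$N$ limit of the M2-brane algebra, i.e. the 1-shifted affine Yangian of $\mathfrak{gl}_1$), with elements $t_{m,n}$, $m,n\ge 0$, satisfying $[t_{0,0},t_{c,d}]=0$, $[t_{1,0},t_{c,d}]=d\,t_{c,d-1}$, $[t_{0,1},t_{c,d}]=-c\,t_{c-1,d}$, $[t_{2,0},t_{c,d}]=2d\,t_{c+1,d-1}$, $[t_{1,1},t_{c,d}]=(d-c)t_{c,d}$, $[t_{0,2},t_{c,d}]=-2c\,t_{c-1,d+1}$, and $[t_{3,0},t_{c,d}]=3d\,t_{c+2,d-1}+\sigma_2\frac{d(d-1)(d-2)}{4}t_{c,d-3}+\frac{3}{2}\sigma_3\sum_{m=0}^{d-3}\sum_{n=0}^{c}\frac{\binom{m+n+1}{n+1}(n+1)\binom{d-m+c-n-2}{c-n+1}(c-n+1)}{\binom{d+c}{c}}t_{n,m}t_{c-n,d-3-m}$; $\mathcal{A}$ is generated as an algebra by $t_{2,0}$ and $t_{0,n}$, $n\ge0$. The coproduct $\Delta_{\mathcal{A}}:\mathcal{A}\to(\mathcal{A}\otimes\mathcal{A})(\!(w^{-1})\!)$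 is the algebra homomorphism determined by $\Delta_{\mathcal{A}}(t_{0,n})=1\otimes t_{0,n}+\sum_{m=0}^n\binom{n}{m}w^{n-m}t_{0,m}\otimes 1$, $\Delta_{\mathcal{A}}(t_{2,0})=1\otimes t_{2,0}+t_{2,0}\otimes 1+2\sigma_3\sum_{m,n\ge0}\frac{(m+n+1)!}{m!\,n!}(-1)^n w^{-n-m-2}\,t_{0,n}\otimes t_{0,m}$. Maps such as $\mathrm{Id}\otimes Y(w_2)$ are extended to formal series coefficientwise. The formal delta series is $\delta\!\left(\frac{y-x}{z}\right)=\sum_{m\ge0,n\in\mathbb{Z}}\binom{n}{m}y^{n-m}x^m z^{-n}$ (with $\binom{n}{m}$ the generalized binomial coefficient), and $T:V_1\otimes V_2\to V_2\otimes V_1$ swaps the two tensor factors (here applied to the first two factors of $\mathcal{A}^{\otimes3}$).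
   Formalization: The delta series is taken with the sign (-1)^m on x^m, i.e. as the expansion of (y-x)^n; the unsigned formula given for it makes the Jacobi identity false already for v=1 (coefficient of w_0^{-2}: 2(w_1+w_2) against 0). *)

theory Defs
  imports Complex_Main
begin

text \<open>
  Concrete model.  A letter (j,m,n) is the generator t_{m,n} placed in the j-th tensor
  factor.  Elements of the free associative algebra on letters are finitely supported
  functions from words to complex coefficients.  A^{\<otimes>K} is the free algebra on letters
  with j < K modulo the two-sided ideal idl s2 s3 K generated by the defining relations
  in every factor and by the commutation of generators lying in different factors.
  Formal series in one variable w are functions int => fa (coefficient of w^k).
\<close>

type_synonym gen = "nat \<times> nat \<times> nat"
type_synonym fa = "gen list \<Rightarrow> complex"
type_synonym ser = "int \<Rightarrow> fa"

definition sig2 :: "complex \<Rightarrow> complex \<Rightarrow> complex" where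
  "sig2 e1 e2 = e1^2 + e1*e2 + e2^2"
definition sig3 :: "complex \<Rightarrow> complex \<Rightarrow> complex \<Rightarrow> complex" where
  "sig3 e1 e2 e3 = e1*e2*e3"

definition fzero :: fa where "fzero = (\<lambda>u. 0)"
definition fone :: fa where "fone = (\<lambda>u. if u = [] then 1 else 0)"
definition tg :: "nat \<Rightarrow> nat \<Rightarrow> nat \<Rightarrow> fa" where
  "tg j m n = (\<lambda>u. if u = [(j,m,n)] then 1 else 0)"
definition fadd :: "fa \<Rightarrow> fa \<Rightarrow> fa" where "fadd p q = (\<lambda>u. p u + q u)"
definition fsc :: "complex \<Rightarrow> fa \<Rightarrow> fa" where "fsc c p = (\<lambda>u. c * p u)"
definition fminus :: "fa \<Rightarrow> fa \<Rightarrow> fa" where "fminus p q = fadd p (fsc (-1) q)"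
definition fmul :: "fa \<Rightarrow> fa \<Rightarrow> fa" where
  "fmul p q = (\<lambda>u. \<Sum>i\<le>length u. p (take i u) * q (drop i u))"
definition fcomm :: "fa \<Rightarrow> fa \<Rightarrow> fa" where "fcomm p q = fminus (fmul p q) (fmul q p)"
definition fsumset :: "'i set \<Rightarrow> ('i \<Rightarrow> fa) \<Rightarrow> fa" where
  "fsumset S f = (\<lambda>u. \<Sum>i\<in>S. f i u)"
definition fsum :: "('i \<Rightarrow> fa) \<Rightarrow> fa" where
  "fsum f = fsumset {i. f i \<noteq> fzero} f"

definition finsupp :: "fa \<Rightarrow> bool" where "finsupp p \<longleftrightarrow> finite {u. p u \<noteq> 0}"

definition rel_copy :: "complex \<Rightarrow> complex \<Rightarrow> nat \<Rightarrow> nat \<Rightarrow> nat \<Rightarrow> fa set" where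
  "rel_copy s2 s3 j c d = {
     fcomm (tg j 0 0) (tg j c d),
     fminus (fcomm (tg j 1 0) (tg j c d)) (fsc (of_nat d) (tg j c (d-1))),
     fadd (fcomm (tg j 0 1) (tg j c d)) (fsc (of_nat c) (tg j (c-1) d)),
     fminus (fcomm (tg j 2 0) (tg j c d)) (fsc (2 * of_nat d) (tg j (c+1) (d-1))),
     fminus (fcomm (tg j 1 1) (tg j c d)) (fsc (of_nat d - of_nat c) (tg j c d)),
     fadd (fcomm (tg j 0 2) (tg j c d)) (fsc (2 * of_nat c) (tg j (c-1) (d+1))),
     fminus (fcomm (tg j 3 0) (tg j c d))
       (fadd (fsc (3 * of_nat d) (tg j (c+2) (d-1)))
        (fadd (fsc (s2 * of_nat (d*(d-1)*(d-2)) / 4) (tg j c (d-3)))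
          (if d \<ge> 3 then
             fsumset ({0..d-3} \<times> {0..c}) (\<lambda>(m,n).
               fsc (3/2 * s3 * (of_nat ((m+n+1) choose (n+1)) * of_nat (n+1)
                     * of_nat ((d-m+c-n-2) choose (c-n+1)) * of_nat (c-n+1))
                     / of_nat ((d+c) choose c))
                 (fmul (tg j n m) (tg j (c-n) (d-3-m))))
           else fzero)))}"

definition rels :: "complex \<Rightarrow> complex \<Rightarrow> nat \<Rightarrow> fa set" where
  "rels s2 s3 K = (\<Union>j\<in>{..<K}. \<Union>c. \<Union>d. rel_copy s2 s3 j c d)
     \<union> {fcomm (tg i m n) (tg j m' n') | i j m n m' n'. i < K \<and> j < K \<and> i \<noteq> j}"

inductive_set idl :: "complex \<Rightarrow> complex \<Rightarrow> nat \<Rightarrow> fa set" for s2 s3 K where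
  gen: "r \<in> rels s2 s3 K \<Longrightarrow> r \<in> idl s2 s3 K"
| zero: "fzero \<in> idl s2 s3 K"
| add: "x \<in> idl s2 s3 K \<Longrightarrow> y \<in> idl s2 s3 K \<Longrightarrow> fadd x y \<in> idl s2 s3 K"
| scal: "x \<in> idl s2 s3 K \<Longrightarrow> fsc c x \<in> idl s2 s3 K"
| mult: "x \<in> idl s2 s3 K \<Longrightarrow> finsupp a \<Longrightarrow> finsupp b \<Longrightarrow> fmul a (fmul x b) \<in> idl s2 s3 K"

definition eqv :: "complex \<Rightarrow> complex \<Rightarrow> nat \<Rightarrow> fa \<Rightarrow> fa \<Rightarrow> bool" where
  "eqv s2 s3 K p q \<longleftrightarrow> fminus p q \<in> idl s2 s3 K"

definition sone :: ser where "sone = (\<lambda>k. if k = 0 then fone else fzero)"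
definition sconst :: "fa \<Rightarrow> ser" where "sconst p = (\<lambda>k. if k = 0 then p else fzero)"
definition sadd :: "ser \<Rightarrow> ser \<Rightarrow> ser" where "sadd s t = (\<lambda>k. fadd (s k) (t k))"
definition ssc :: "complex \<Rightarrow> ser \<Rightarrow> ser" where "ssc c s = (\<lambda>k. fsc c (s k))"
definition smul :: "ser \<Rightarrow> ser \<Rightarrow> ser" where
  "smul s t = (\<lambda>k. fsum (\<lambda>i::int. fmul (s i) (t (k - i))))"
definition scomm :: "ser \<Rightarrow> ser \<Rightarrow> ser" where
  "scomm s t = sadd (smul s t) (ssc (-1) (smul t s))"

text \<open>Coproduct on generators, with first factor a and second factor b.\<close>
definition D0 :: "nat \<Rightarrow> nat \<Rightarrow> nat \<Rightarrow> ser" where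
  "D0 a b n = (\<lambda>k. fadd (if k = 0 then tg b 0 n else fzero)
      (if 0 \<le> k \<and> k \<le> int n then fsc (of_nat (n choose (n - nat k))) (tg a 0 (n - nat k))
       else fzero))"

definition D20 :: "complex \<Rightarrow> nat \<Rightarrow> nat \<Rightarrow> ser" where
  "D20 s3 a b = (\<lambda>k. if k = 0 then fadd (tg b 2 0) (tg a 2 0)
      else if k \<le> -2 then
        fsumset {(n,m). n + m = nat (-k-2)} (\<lambda>(n,m).
          fsc (2 * s3 * of_nat (fact (m+n+1)) / (of_nat (fact m) * of_nat (fact n)) * (-1)^n)
            (fmul (tg a 0 n) (tg b 0 m)))
      else fzero)"

text \<open>Values on the remaining generators, forced by t_{m+1,d} = [t_{2,0},t_{m,d+1}]/(2(d+1)).\<close>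
fun Dl :: "complex \<Rightarrow> nat \<Rightarrow> nat \<Rightarrow> nat \<Rightarrow> nat \<Rightarrow> ser" where
  "Dl s3 a b 0 n = D0 a b n"
| "Dl s3 a b (Suc m) d = (if Suc m = 2 \<and> d = 0 then D20 s3 a b
     else ssc (1 / (2 * of_nat (d+1))) (scomm (D20 s3 a b) (Dl s3 a b m (d+1))))"

definition wimg :: "(gen \<Rightarrow> ser) \<Rightarrow> gen list \<Rightarrow> ser" where
  "wimg \<phi> w = foldr (\<lambda>l acc. smul (\<phi> l) acc) w sone"
definition ext :: "(gen \<Rightarrow> ser) \<Rightarrow> fa \<Rightarrow> ser" where
  "ext \<phi> p = (\<lambda>k. fsum (\<lambda>w. fsc (p w) (wimg \<phi> w k)))"

definition Y :: "complex \<Rightarrow> fa \<Rightarrow> ser" where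
  "Y s3 = ext (\<lambda>(j,m,n). Dl s3 0 1 m n)"
definition IdY :: "complex \<Rightarrow> fa \<Rightarrow> ser" where
  "IdY s3 = ext (\<lambda>(j,m,n). if j = 0 then sconst (tg 0 m n) else Dl s3 1 2 m n)"
definition YId :: "complex \<Rightarrow> fa \<Rightarrow> ser" where
  "YId s3 = ext (\<lambda>(j,m,n). if j = 0 then Dl s3 0 1 m n else sconst (tg 2 m n))"

definition swl :: "gen \<Rightarrow> gen" where
  "swl = (\<lambda>(j,m,n). (if j = 0 then 1 else if j = 1 then 0 else j, m, n))"
definition Tsw :: "fa \<Rightarrow> fa" where "Tsw p = (\<lambda>u. p (map swl u))"

text \<open>Counit applied to first / second factor of A\<otimes>A.\<close>
definition cId :: "fa \<Rightarrow> fa" where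
  "cId p = (\<lambda>u. if (\<forall>l\<in>set u. fst l = 0) then p (map (\<lambda>(j,m,n). (1,m,n)) u) else 0)"
definition Idc :: "fa \<Rightarrow> fa" where
  "Idc p = (\<lambda>u. if (\<forall>l\<in>set u. fst l = 0) then p u else 0)"

definition gbin :: "int \<Rightarrow> nat \<Rightarrow> complex" where "gbin n m = (of_int n) gchoose m"

text \<open>Coefficient of w0^i0 w1^i1 w2^i2 in w0^{-1} delta((w1-w2)/w0) F(w1,w2).\<close>
definition J1 :: "(int \<Rightarrow> int \<Rightarrow> fa) \<Rightarrow> int \<Rightarrow> int \<Rightarrow> int \<Rightarrow> fa" where
  "J1 F i0 i1 i2 = fsum (\<lambda>m::nat. fsc (gbin (-i0-1) m * (-1)^m)
                         (F (i1 - (-i0-1) + int m) (i2 - int m)))"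
text \<open>Coefficient of w0^i0 w1^i1 w2^i2 in w0^{-1} delta((w2-w1)/(-w0)) G(w1,w2).\<close>
definition J2 :: "(int \<Rightarrow> int \<Rightarrow> fa) \<Rightarrow> int \<Rightarrow> int \<Rightarrow> int \<Rightarrow> fa" where
  "J2 G i0 i1 i2 = fsum (\<lambda>m::nat. fsc (gbin (-i0-1) m * (-1) powi ((-i0-1) + int m))
                         (G (i1 - int m) (i2 - (-i0-1) + int m)))"
text \<open>Coefficient of w0^i0 w1^i1 w2^i2 in w2^{-1} delta((w1-w0)/w2) K(w0,w2).\<close>
definition J3 :: "(int \<Rightarrow> int \<Rightarrow> fa) \<Rightarrow> int \<Rightarrow> int \<Rightarrow> int \<Rightarrow> fa" where
  "J3 K i0 i1 i2 = fsum (\<lambda>m::nat. fsc (gbin (i1 + int m) m * (-1)^m)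
                         (K (i0 - int m) (i2 + i1 + int m + 1)))"

end

theory Submission
  imports Defs "HOL-Library.Poly_Mapping" "HOL-Computational_Algebra.Formal_Laurent_Series"
begin

text \<open>
  The three iterated coproducts are expansions, in \<open>|w\<^sub>1| > |w\<^sub>2|\<close>, \<open>|w\<^sub>2| > |w\<^sub>1|\<close> and
  \<open>|w\<^sub>2| > |w\<^sub>1 - w\<^sub>2|\<close>, of one and the same algebra homomorphism into elements of \<open>A \<otimes> A \<otimes> A\<close> with
  coefficients in \<open>\<complex>[w\<^sub>1\<^sup>\<plusminus>, w\<^sub>2\<^sup>\<plusminus>, (w\<^sub>1 - w\<^sub>2)\<^sup>\<plusminus>]\<close>, completed with respect to the total degree.  The
  triples of series that agree modulo the ideal, in every total degree, with such a triple of
  expansions form an algebra, so it suffices to look at \<open>t\<^sub>0\<^sub>,\<^sub>n\<close> and \<open>t\<^sub>2\<^sub>,\<^sub>0\<close>, where only the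
  commutation of different tensor factors is used.  For a single monomial the Jacobi identity says
  that the residues at three points of the projective line add up to zero.  The counit axioms
  propagate in the same way from \<open>t\<^sub>0\<^sub>,\<^sub>n\<close> and \<open>t\<^sub>2\<^sub>,\<^sub>0\<close> by means of the relation for \<open>[t\<^sub>2\<^sub>,\<^sub>0, t\<^sub>c\<^sub>,\<^sub>d]\<close>.
\<close>

text \<open>The coproduct of t_{2,0} is an infinite series, so its iterated images are not
  expansions of a single Laurent polynomial, and an identity proved monomial by monomial does not
  apply to them directly. What rescues it: the coefficient of w0^i0 w1^i1 w2^i2 in the Jacobi
  identity reads, in each of the three series, only coefficients of total degree i0 + i1 + i2 + 1.
  Hence agreement down to that degree suffices, and since total degrees are bounded above,
  approximations can be multiplied. The common source of the three series is visible from generating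
  functions. Write x_j^n symbolically for t_{0,n} in factor j. The coproduct translates the first
  factor by w and adds to t_{2,0} the interaction 2 sigma3 (w + x_0 - x_1)^(-2). All three
  iterations translate the factors 0, 1, 2 by w1, w2, 0 and give one interaction for each pair
  (0,2), (1,2), (0,1), with w1, w2, w1 - w2 in place of w. The even exponent makes the last one
  invariant under the swap.\<close>

unbundle fps_syntax

section \<open>The free algebra as a monoid ring over words\<close>

instantiation list :: (type) monoid_add
begin
definition zero_list :: "'a list" where "0 = []"
definition plus_list :: "'a list \<Rightarrow> 'a list \<Rightarrow> 'a list" where "xs + ys = xs @ ys"
instance by standard (simp_all add: zero_list_def plus_list_def)
end

alias lookup = Poly_Mapping.lookup
alias keys = Poly_Mapping.keys

text \<open>With concatenation as the addition on words, convolution of finitely supported functions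
  is the product of the free algebra, so ring laws are available for representatives.\<close>

type_synonym falg = "gen list \<Rightarrow>\<^sub>0 complex"

definition scal :: "complex \<Rightarrow> falg" where "scal c = Poly_Mapping.single 0 c"
definition gn :: "nat \<Rightarrow> nat \<Rightarrow> nat \<Rightarrow> falg" where "gn j m n = Poly_Mapping.single [(j,m,n)] 1"

lemma sum_take_image:
  "(\<Sum>l\<in>(\<lambda>i. take i u) ` {..length u}. f l) = (\<Sum>i\<le>length u. f (take i u))"
proof -
  have "inj_on (\<lambda>i. take i u) {..length u}"
    by (rule inj_onI) (metis atMost_iff length_take min.absorb2)
  then show ?thesis by (simp add: sum.reindex)
qed

text \<open>A prefix of \<open>u\<close> determines the remaining factor, so the double sum of the
  convolution collapses to one sum over cut points.\<close>

lemma lookup_times: "lookup (x * y) = fmul (lookup x) (lookup y)" for x y :: falg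
proof
  fix u
  have inner: "(\<Sum>q. lookup y q when u = l + q) =
      (if l \<in> (\<lambda>i. take i u) ` {..length u} then lookup y (drop (length l) u) else 0)" for l
  proof (cases "l \<in> (\<lambda>i. take i u) ` {..length u}")
    case True
    then have l: "take (length l) u = l" by auto
    have eq: "u = l + q \<longleftrightarrow> drop (length l) u = q" for q
      unfolding plus_list_def by (metis l append_eq_conv_conj append_take_drop_id)
    show ?thesis using True by (simp add: eq)
  next
    case False
    have "u \<noteq> l + q" for q
      using False unfolding plus_list_def by (auto intro!: image_eqI[of _ _ "length l"])
    then show ?thesis using False by simp
  qed
  have "lookup (x * y) u = (\<Sum>l\<in>(\<lambda>i. take i u) ` {..length u}. lookup x l * lookup y (drop (length l) u))"
    unfolding lookup_mult inner
    by (subst Sum_any.expand_superset[where A = "(\<lambda>i. take i u) ` {..length u}"]) auto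
  also have "\<dots> = fmul (lookup x) (lookup y) u"
    unfolding sum_take_image fmul_def by (rule sum.cong) auto
  finally show "lookup (x * y) u = fmul (lookup x) (lookup y) u" .
qed

lemma lookup_scal_times: "lookup (scal c * x) = fsc c (lookup x)"
proof
  fix u
  have "(\<Sum>i\<le>length u. (c when i = 0) * lookup x (drop i u)) = c * lookup x u"
    by (simp add: when_def if_distrib[of "\<lambda>c. c * _"] cong: if_cong)
  moreover have "lookup (scal c) (take i u) = (c when i = 0)" if "i \<le> length u" for i
    using that by (auto simp: scal_def lookup_single zero_list_def when_def)
  ultimately show "lookup (scal c * x) u = fsc c (lookup x) u"
    by (simp add: lookup_times fmul_def fsc_def)
qed

lemma lookup_plus: "lookup (x + y) = fadd (lookup x) (lookup y)" for x y :: falg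
  by (simp add: fun_eq_iff lookup_add fadd_def)

lemma lookup_diff: "lookup (x - y) = fminus (lookup x) (lookup y)" for x y :: falg
  by (simp add: fun_eq_iff lookup_minus fminus_def fadd_def fsc_def)

lemma lookup_0: "lookup (0::falg) = fzero"
  by (simp add: fun_eq_iff fzero_def)

lemma lookup_1: "lookup (1::falg) = fone"
  by (simp add: fun_eq_iff fone_def lookup_one zero_list_def when_def)

lemma lookup_gn: "lookup (gn j m n) = tg j m n"
  by (auto simp: fun_eq_iff gn_def tg_def lookup_single when_def)

lemma lookup_fsumset: "fsumset S (\<lambda>i. lookup (f i)) = lookup (sum f S)" for f :: "_ \<Rightarrow> falg"
  by (simp add: fun_eq_iff fsumset_def lookup_sum)

lemma lookup_fcomm: "lookup (x * y - y * x) = fcomm (lookup x) (lookup y)" for x y :: falg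
  by (simp add: fcomm_def lookup_diff lookup_times)

lemma lookup_eq_fzero: "lookup x = fzero \<longleftrightarrow> x = 0" for x :: falg
  by (metis lookup_0 lookup_inject)

lemma lookup_fsum: "fsum (\<lambda>i. lookup (f i)) = lookup (Sum_any f)" for f :: "_ \<Rightarrow> falg"
  by (simp add: fsum_def Sum_any.expand_set lookup_fsumset lookup_eq_fzero)

lemma finsupp_lookup [simp]: "finsupp (lookup x)" for x :: falg
  by (simp add: finsupp_def)

lemma ex_lookup:
  assumes "finsupp p" shows "\<exists>x::falg. p = lookup x"
  using assms unfolding finsupp_def by (metis lookup_Abs_poly_mapping)

lemma scal_add: "scal (a + b) = scal a + scal b"
  by (simp add: scal_def single_add)
lemma scal_mult: "scal (a * b) = scal a * scal b"
  by (simp add: scal_def mult_single)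
lemma scal_0 [simp]: "scal 0 = 0" and scal_1 [simp]: "scal 1 = 1"
  by (simp_all add: scal_def)
lemma scal_uminus: "scal (- a) = - scal a"
  by (simp add: scal_def single_uminus)
lemma scal_comm: "scal c * x = x * scal c"
proof (rule poly_mapping_eqI)
  fix u
  have "lookup (x * scal c) u = (\<Sum>i\<le>length u. lookup x (take i u) * (c when i = length u))"
    unfolding lookup_times fmul_def
    by (rule sum.cong) (auto simp: scal_def lookup_single zero_list_def when_def)
  also have "\<dots> = lookup x u * c"
    by (simp add: when_def if_distrib[of "\<lambda>c. _ * c"] cong: if_cong)
  finally show "lookup (scal c * x) u = lookup (x * scal c) u"
    by (simp add: lookup_scal_times fsc_def)
qed
lemma scal_left_comm: "x * (scal c * y) = scal c * (x * y)"
  by (metis mult.assoc scal_comm)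

subsection \<open>Homomorphisms out of the free algebra\<close>

text \<open>Targets are \<open>falg\<close> and its Laurent series. Letting the complex numbers act
  through a central map \<open>\<kappa>\<close> gives both the same universal property of the free
  algebra.\<close>

locale scalars =
  fixes \<kappa> :: "complex \<Rightarrow> 'b::ring_1"
  assumes \<kappa>_add: "\<kappa> (a + b) = \<kappa> a + \<kappa> b"
    and \<kappa>_mult: "\<kappa> (a * b) = \<kappa> a * \<kappa> b"
    and \<kappa>_1: "\<kappa> 1 = 1"
    and \<kappa>_comm: "\<kappa> c * x = x * \<kappa> c"
begin

lemma \<kappa>_0: "\<kappa> 0 = 0"
  using \<kappa>_add[of 0 0] by simp

end

definition evh :: "(complex \<Rightarrow> 'b::ring_1) \<Rightarrow> (gen \<Rightarrow> 'b) \<Rightarrow> falg \<Rightarrow> 'b" where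
  "evh \<kappa> \<phi> x = (\<Sum>w\<in>keys x. \<kappa> (lookup x w) * prod_list (map \<phi> w))"

definition alg_hom :: "(complex \<Rightarrow> 'b::ring_1) \<Rightarrow> (falg \<Rightarrow> 'b) \<Rightarrow> bool" where
  "alg_hom \<kappa> h \<longleftrightarrow> (\<forall>x y. h (x + y) = h x + h y) \<and> (\<forall>x y. h (x * y) = h x * h y)
     \<and> (\<forall>c. h (scal c) = \<kappa> c)"

lemma sum_monomials: "x = (\<Sum>w\<in>keys x. Poly_Mapping.single w (lookup x w))" for x :: falg
  by (rule poly_mapping_eqI)
    (simp add: lookup_sum lookup_single when_def in_keys_iff)

context scalars
begin

lemma evh_superset:
  assumes "finite S" "keys x \<subseteq> S"
  shows "evh \<kappa> \<phi> x = (\<Sum>w\<in>S. \<kappa> (lookup x w) * prod_list (map \<phi> w))"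
  unfolding evh_def
  by (rule sum.mono_neutral_left) (use assms in \<open>auto simp: in_keys_iff \<kappa>_0\<close>)

lemma evh_add: "evh \<kappa> \<phi> (x + y) = evh \<kappa> \<phi> x + evh \<kappa> \<phi> y"
proof -
  let ?S = "keys x \<union> keys y"
  have "evh \<kappa> \<phi> (x + y) = (\<Sum>w\<in>?S. \<kappa> (lookup (x + y) w) * prod_list (map \<phi> w))"
    by (rule evh_superset) (simp_all add: keys_add)
  also have "\<dots> = evh \<kappa> \<phi> x + evh \<kappa> \<phi> y"
    by (simp add: evh_superset[of ?S] lookup_add \<kappa>_add distrib_right sum.distrib)
  finally show ?thesis .
qed

lemma evh_0: "evh \<kappa> \<phi> 0 = 0"
  by (simp add: evh_def)

lemma evh_sum: "evh \<kappa> \<phi> (sum f S) = (\<Sum>i\<in>S. evh \<kappa> \<phi> (f i))"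
  by (induction S rule: infinite_finite_induct) (simp_all add: evh_0 evh_add)

lemma evh_single: "evh \<kappa> \<phi> (Poly_Mapping.single w c) = \<kappa> c * prod_list (map \<phi> w)"
  by (cases "c = 0") (simp_all add: evh_def \<kappa>_0)

lemma evh_mult: "evh \<kappa> \<phi> (x * y) = evh \<kappa> \<phi> x * evh \<kappa> \<phi> y"
proof -
  have 1: "evh \<kappa> \<phi> (Poly_Mapping.single u a * Poly_Mapping.single v b) =
     evh \<kappa> \<phi> (Poly_Mapping.single u a) * evh \<kappa> \<phi> (Poly_Mapping.single v b)" for u v a b
  proof -
    let ?p = "prod_list (map \<phi> u)" and ?q = "prod_list (map \<phi> v)"
    have "evh \<kappa> \<phi> (Poly_Mapping.single u a * Poly_Mapping.single v b) = \<kappa> a * \<kappa> b * (?p * ?q)"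
      by (simp add: mult_single evh_single \<kappa>_mult plus_list_def)
    also have "\<dots> = \<kappa> a * (?p * \<kappa> b * ?q)"
      by (simp only: \<kappa>_comm[of b ?p, symmetric] mult.assoc)
    finally show ?thesis by (simp add: evh_single mult.assoc)
  qed
  have "evh \<kappa> \<phi> ((\<Sum>u\<in>keys x. Poly_Mapping.single u (lookup x u)) *
       (\<Sum>v\<in>keys y. Poly_Mapping.single v (lookup y v))) =
     evh \<kappa> \<phi> (\<Sum>u\<in>keys x. Poly_Mapping.single u (lookup x u)) *
     evh \<kappa> \<phi> (\<Sum>v\<in>keys y. Poly_Mapping.single v (lookup y v))"
    by (simp add: sum_product evh_sum 1)
  then show ?thesis by (simp only: sum_monomials[symmetric])
qed

lemma alg_hom_evh: "alg_hom \<kappa> (evh \<kappa> \<phi>)"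
  unfolding alg_hom_def scal_def
  by (simp add: evh_add evh_mult evh_single zero_list_def)

lemma evh_gn: "evh \<kappa> \<phi> (gn j m n) = \<phi> (j, m, n)"
  by (simp add: gn_def evh_single \<kappa>_1)

end

text \<open>Only generators occurring in the given element have to be treated. The counit axioms
  need this: they concern elements whose letters all lie in factor 0.\<close>

lemma falg_induct [case_names scal gn add mult]:
  assumes "\<And>c. P (scal c)"
    and "\<And>j m n. (\<exists>u. lookup x u \<noteq> 0 \<and> (j,m,n) \<in> set u) \<Longrightarrow> P (gn j m n)"
    and "\<And>x y. P x \<Longrightarrow> P y \<Longrightarrow> P (x + y)"
    and "\<And>x y. P x \<Longrightarrow> P y \<Longrightarrow> P (x * y)"
  shows "P x"
proof -
  have word: "P (Poly_Mapping.single w c)"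
    if "\<And>j m n. (j,m,n) \<in> set w \<Longrightarrow> P (gn j m n)" for w c
    using that
  proof (induction w)
    case Nil then show ?case using assms(1)[of c] by (simp add: scal_def zero_list_def)
  next
    case (Cons l w)
    obtain j m n where l: "l = (j,m,n)" by (cases l)
    have "Poly_Mapping.single (l # w) c = gn j m n * Poly_Mapping.single w c"
      by (simp add: gn_def mult_single plus_list_def l)
    with Cons show ?case by (auto simp: l intro: assms(4))
  qed
  have "P (\<Sum>w\<in>S. Poly_Mapping.single w (lookup x w))" if "S \<subseteq> keys x" for S
    using finite_subset[OF that finite_keys] that
  proof (induction S rule: finite_induct)
    case empty then show ?case using assms(1)[of 0] by simp
  next
    case (insert w S)
    then show ?case
      by (auto intro!: assms(3) word assms(2) simp: in_keys_iff)
  qed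
  from this[OF order_refl] show ?thesis by (simp only: sum_monomials[symmetric])
qed

subsection \<open>Coefficientwise maps of Laurent series\<close>

text \<open>Arbitrary lower bounds replace the subdegrees, which may jump when a map is applied to
  all coefficients; the same window then serves a product and its image.\<close>

lemma fls_nth_times_bound:
  fixes f g :: "'a::semiring_0 fls"
  assumes "\<And>i. i < a \<Longrightarrow> f $$ i = 0" "\<And>i. i < b \<Longrightarrow> g $$ i = 0"
  shows "(f * g) $$ n = (\<Sum>i=a..n-b. f $$ i * g $$ (n - i))"
proof (cases "f = 0 \<or> g = 0")
  case False
  have "a \<le> fls_subdegree f" "b \<le> fls_subdegree g"
    using False assms by (auto intro!: fls_subdegree_geI)
  then show ?thesis
    unfolding fls_times_nth(2)
    by (intro sum.mono_neutral_left) auto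
qed auto

lemma fls_bounded_below: "\<exists>a. \<forall>i<a. f $$ i = 0"
  by (meson fls_eq0_below_subdegree)

definition fls_map :: "('a::zero \<Rightarrow> 'b::zero) \<Rightarrow> 'a fls \<Rightarrow> 'b fls" where
  "fls_map h f = Abs_fls (\<lambda>n. h (f $$ n))"

lemma fls_map_nth:
  assumes "h 0 = 0" shows "fls_map h f $$ n = h (f $$ n)"
  unfolding fls_map_def
  by (rule nth_Abs_fls_ex_lower_bound) (metis assms fls_eq0_below_subdegree)

locale ring_hom =
  fixes h :: "'a::ring_1 \<Rightarrow> 'b::ring_1"
  assumes h_add: "h (x + y) = h x + h y" and h_mult: "h (x * y) = h x * h y"
begin

lemma h_0 [simp]: "h 0 = 0" using h_add[of 0 0] by simp
lemma h_uminus: "h (- x) = - h x" using h_add[of x "- x"] by (simp add: eq_neg_iff_add_eq_0 add.commute)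
lemma h_diff: "h (x - y) = h x - h y" using h_add[of x "- y"] by (simp add: h_uminus)
lemma h_sum: "h (sum f S) = (\<Sum>i\<in>S. h (f i))"
  by (induction S rule: infinite_finite_induct) (simp_all add: h_add)

lemma map_nth [simp]: "fls_map h f $$ n = h (f $$ n)"
  by (simp add: fls_map_nth)

lemma ring_hom_map: "ring_hom (fls_map h)"
proof
  fix f g :: "'a fls"
  show "fls_map h (f + g) = fls_map h f + fls_map h g"
    by (rule fls_eqI) (simp add: h_add)
  obtain a b where ab: "\<And>i. i < a \<Longrightarrow> f $$ i = 0" "\<And>i. i < b \<Longrightarrow> g $$ i = 0"
    using fls_bounded_below by metis
  show "fls_map h (f * g) = fls_map h f * fls_map h g"
  proof (rule fls_eqI)
    fix n
    have "(fls_map h f * fls_map h g) $$ n = (\<Sum>i=a..n-b. h (f $$ i) * h (g $$ (n - i)))"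
      by (subst fls_nth_times_bound[of a _ b]) (simp_all add: ab)
    then show "fls_map h (f * g) $$ n = (fls_map h f * fls_map h g) $$ n"
      by (simp add: fls_nth_times_bound[of a f b g] ab h_sum h_mult)
  qed
qed

end

lemma alg_hom_ring_hom: "alg_hom \<kappa> h \<Longrightarrow> ring_hom h"
  by unfold_locales (simp_all add: alg_hom_def)

lemma scalars_const:
  assumes "scalars \<kappa>" shows "scalars (\<lambda>c. fls_const (\<kappa> c))"
proof -
  interpret scalars \<kappa> by fact
  show ?thesis
  proof
    show "fls_const (\<kappa> c) * x = x * fls_const (\<kappa> c)" for c and x :: "'a fls"
      by (rule fls_eqI) (simp only: fls_mult_const_nth \<kappa>_comm)
  qed (simp_all add: \<kappa>_add \<kappa>_mult \<kappa>_1 fls_plus_const)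
qed

lemma scalars_scal: "scalars scal"
  by unfold_locales (simp_all add: scal_add scal_mult, rule scal_comm)

lemma alg_hom_comp_map:
  assumes "alg_hom (\<lambda>c. fls_const (scal c)) g" "alg_hom \<kappa> h"
  shows "alg_hom (\<lambda>c. fls_const (\<kappa> c)) (\<lambda>x. fls_map h (g x))"
proof -
  interpret h: ring_hom h using assms(2) by (rule alg_hom_ring_hom)
  interpret H: ring_hom "fls_map h" by (rule h.ring_hom_map)
  show ?thesis using assms
    by (auto simp: alg_hom_def H.h_add H.h_mult intro!: fls_eqI)
qed

subsection \<open>Transport to the free algebra and its Laurent series\<close>

text \<open>Series bounded above in powers of \<open>w\<close> become Laurent series in \<open>1 / w\<close>, hence the sign.\<close>

definition ser_of :: "falg fls \<Rightarrow> ser" where "ser_of f = (\<lambda>k. lookup (f $$ (- k)))"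

lemma ser_of_1: "sone = ser_of 1"
  by (auto simp: sone_def ser_of_def fun_eq_iff lookup_0[symmetric] lookup_1[symmetric])

lemma ser_of_const: "sconst (lookup x) = ser_of (fls_const x)"
  by (auto simp: sconst_def ser_of_def fun_eq_iff lookup_0[symmetric])

lemma ser_of_add: "sadd (ser_of f) (ser_of g) = ser_of (f + g)"
  by (simp add: sadd_def ser_of_def lookup_plus)

lemma ser_of_scal: "ssc c (ser_of f) = ser_of (fls_const (scal c) * f)"
  by (simp add: ssc_def ser_of_def lookup_scal_times)

lemma ser_of_mult: "smul (ser_of f) (ser_of g) = ser_of (f * g)"
proof
  fix k
  obtain a b where ab: "\<And>i. i < a \<Longrightarrow> f $$ i = 0" "\<And>i. i < b \<Longrightarrow> g $$ i = 0"
    using fls_bounded_below by metis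
  \<comment> \<open>In powers of 1 / w both supports are bounded below, which cuts the sum over all
    integers down to a finite window.\<close>
  have *: "f $$ (- i) * g $$ (- (k - i)) = 0" if "i \<notin> {k + b..- a}" for i
  proof (cases "- i < a")
    case True then show ?thesis using ab(1)[of "- i"] by simp
  next
    case False
    then have "- (k - i) < b" using that by auto
    then show ?thesis using ab(2)[of "- (k - i)"] by simp
  qed
  have "(\<Sum>i. f $$ (- i) * g $$ (- (k - i))) = (\<Sum>i\<in>{k + b..- a}. f $$ (- i) * g $$ (- (k - i)))"
    by (rule Sum_any.expand_superset) (auto, (use * in force)+)
  also have "\<dots> = (\<Sum>i=a..- k - b. f $$ i * g $$ (- k - i))"
    by (rule sum.reindex_bij_witness[of _ uminus uminus]) (auto simp: algebra_simps)
  also have "\<dots> = (f * g) $$ (- k)"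
    using fls_nth_times_bound[of a f b g "- k"] ab by simp
  finally show "smul (ser_of f) (ser_of g) k = ser_of (f * g) k"
    by (simp add: smul_def ser_of_def lookup_times[symmetric] lookup_fsum)
qed

lemma ser_of_comm: "scomm (ser_of f) (ser_of g) = ser_of (f * g - g * f)"
  by (simp add: scomm_def ser_of_mult ser_of_scal ser_of_add scal_uminus)

text \<open>The coefficient of x^n y^m in 2 s3 (w + x - y)^(-2), up to the power w^(-n-m-2): with K
  = n + m the quotient of factorials is (K + 1) (K choose n).\<close>

definition coup :: "complex \<Rightarrow> nat \<Rightarrow> nat \<Rightarrow> complex" where
  "coup s3 n m = 2 * s3 * fact (m + n + 1) / (fact m * fact n) * (-1)^n"

text \<open>Symbolically y^n + (x + w)^n, with x in factor \<open>a\<close> and y in factor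
  \<open>b\<close>. Index \<open>i\<close> stands for the power w^(-i), hence the sign
  conditions.\<close>

definition D0F :: "nat \<Rightarrow> nat \<Rightarrow> nat \<Rightarrow> falg fls" where
  "D0F a b n = Abs_fls (\<lambda>i. (if i = 0 then gn b 0 n else 0) +
     (if i \<le> 0 \<and> - i \<le> int n then scal (of_nat (n choose nat (- i))) * gn a 0 (n - nat (- i)) else 0))"

lemma D0F_nth: "D0F a b n $$ i = (if i = 0 then gn b 0 n else 0) +
     (if i \<le> 0 \<and> - i \<le> int n then scal (of_nat (n choose nat (- i))) * gn a 0 (n - nat (- i)) else 0)"
  unfolding D0F_def by (rule nth_Abs_fls_ex_lower_bound) (auto intro: exI[of _ "- int n"])

lemma ser_of_D0F: "D0 a b n = ser_of (D0F a b n)"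
proof
  fix k
  show "D0 a b n k = ser_of (D0F a b n) k"
    by (auto simp: D0_def ser_of_def D0F_nth lookup_plus lookup_scal_times lookup_gn lookup_0
        binomial_symmetric[symmetric] nat_le_iff)
qed

definition D20F :: "complex \<Rightarrow> nat \<Rightarrow> nat \<Rightarrow> falg fls" where
  "D20F s3 a b = Abs_fls (\<lambda>i. (if i = 0 then gn b 2 0 + gn a 2 0 else 0) +
     (if i \<ge> 2 then \<Sum>n\<le>nat (i - 2). scal (coup s3 n (nat (i - 2) - n)) *
         (gn a 0 n * gn b 0 (nat (i - 2) - n)) else 0))"

lemma D20F_nth: "D20F s3 a b $$ i = (if i = 0 then gn b 2 0 + gn a 2 0 else 0) +
     (if i \<ge> 2 then \<Sum>n\<le>nat (i - 2). scal (coup s3 n (nat (i - 2) - n)) *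
         (gn a 0 n * gn b 0 (nat (i - 2) - n)) else 0)"
  unfolding D20F_def by (rule nth_Abs_fls_ex_lower_bound) (auto intro: exI[of _ 0])

lemma ser_of_D20F: "D20 s3 a b = ser_of (D20F s3 a b)"
proof
  fix k
  let ?K = "nat (- k - 2)"
  have "(\<Sum>(n,m)\<in>{(n,m). n + m = ?K}. f n m) = (\<Sum>n\<le>?K. f n (?K - n))" for f :: "nat \<Rightarrow> nat \<Rightarrow> falg"
    by (rule sum.reindex_bij_witness[of _ "\<lambda>n. (n, ?K - n)" fst]) (auto, metis add_diff_cancel_left')
  note * = this[of "\<lambda>n m. scal (coup s3 n m) * (gn a 0 n * gn b 0 m)"]
  have "fsumset {(n,m). n + m = ?K} (\<lambda>(n,m). fsc (2 * s3 * of_nat (fact (m+n+1)) / (of_nat (fact m) * of_nat (fact n)) * (-1)^n)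
            (fmul (tg a 0 n) (tg b 0 m))) = lookup (\<Sum>(n,m)\<in>{(n,m). n + m = ?K}. scal (coup s3 n m) * (gn a 0 n * gn b 0 m))"
    unfolding lookup_fsumset[symmetric] case_prod_unfold lookup_scal_times
    unfolding lookup_times lookup_gn coup_def by (simp only: of_nat_fact)
  then show "D20 s3 a b k = ser_of (D20F s3 a b) k"
    unfolding * by (auto simp: D20_def ser_of_def D20F_nth lookup_plus lookup_gn lookup_0 fadd_def fzero_def)
qed

fun DlF :: "complex \<Rightarrow> nat \<Rightarrow> nat \<Rightarrow> nat \<Rightarrow> nat \<Rightarrow> falg fls" where
  "DlF s3 a b 0 n = D0F a b n"
| "DlF s3 a b (Suc m) d = (if Suc m = 2 \<and> d = 0 then D20F s3 a b
     else fls_const (scal (1 / (2 * of_nat (d+1)))) *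
       (D20F s3 a b * DlF s3 a b m (d+1) - DlF s3 a b m (d+1) * D20F s3 a b))"

lemma ser_of_DlF: "Dl s3 a b m n = ser_of (DlF s3 a b m n)"
  by (induction m arbitrary: n)
    (simp_all add: ser_of_D0F ser_of_D20F ser_of_comm ser_of_scal)

abbreviation fscal :: "complex \<Rightarrow> falg fls" where "fscal \<equiv> \<lambda>c. fls_const (scal c)"

lemma scalars_fscal: "scalars fscal"
  by (rule scalars_const[OF scalars_scal])

lemma fsum_lookup_eq:
  fixes f :: "_ \<Rightarrow> falg"
  assumes "finite S" "\<And>i. i \<notin> S \<Longrightarrow> f i = 0"
  shows "fsum (\<lambda>i. lookup (f i)) = lookup (sum f S)"
  unfolding lookup_fsum by (subst Sum_any.expand_superset[of S]) (use assms in auto)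

lemma ext_lookup:
  assumes "\<And>l. \<phi> l = ser_of (\<psi> l)"
  shows "ext \<phi> (lookup x) k = lookup (evh fscal \<psi> x $$ (- k))"
proof -
  have w: "wimg \<phi> w = ser_of (prod_list (map \<psi> w))" for w
    by (induction w) (simp_all add: wimg_def ser_of_1 assms ser_of_mult)
  have "ext \<phi> (lookup x) k =
     fsum (\<lambda>w. lookup (scal (lookup x w) * prod_list (map \<psi> w) $$ (- k)))"
    unfolding ext_def w by (simp add: ser_of_def lookup_scal_times)
  also have "\<dots> = lookup (\<Sum>w\<in>keys x. scal (lookup x w) * prod_list (map \<psi> w) $$ (- k))"
    by (rule fsum_lookup_eq) (auto simp: in_keys_iff)
  also have "(\<Sum>w\<in>keys x. scal (lookup x w) * prod_list (map \<psi> w) $$ (- k)) = evh fscal \<psi> x $$ (- k)"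
    by (simp add: evh_def fls_nth_sum)
  finally show ?thesis .
qed

section \<open>The coproducts, the swap and the counits as homomorphisms\<close>

definition YF :: "complex \<Rightarrow> falg \<Rightarrow> falg fls" where
  "YF s3 = evh fscal (\<lambda>(j,m,n). DlF s3 0 1 m n)"
definition IdYF :: "complex \<Rightarrow> falg \<Rightarrow> falg fls" where
  "IdYF s3 = evh fscal (\<lambda>(j,m,n). if j = 0 then fls_const (gn 0 m n) else DlF s3 1 2 m n)"
definition YIdF :: "complex \<Rightarrow> falg \<Rightarrow> falg fls" where
  "YIdF s3 = evh fscal (\<lambda>(j,m,n). if j = 0 then DlF s3 0 1 m n else fls_const (gn 2 m n))"

lemma Y_lookup: "Y s3 (lookup x) k = lookup (YF s3 x $$ (- k))"
  unfolding Y_def YF_def by (rule ext_lookup) (auto simp: ser_of_DlF)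

lemma IdY_lookup: "IdY s3 (lookup x) k = lookup (IdYF s3 x $$ (- k))"
  unfolding IdY_def IdYF_def
  by (rule ext_lookup) (auto simp: ser_of_DlF lookup_gn[symmetric] ser_of_const)

lemma YId_lookup: "YId s3 (lookup x) k = lookup (YIdF s3 x $$ (- k))"
  unfolding YId_def YIdF_def
  by (rule ext_lookup) (auto simp: ser_of_DlF lookup_gn[symmetric] ser_of_const)

text \<open>A substitution that is injective on the letters it keeps and kills the others allows at
  most one source word for each \<open>u\<close>, namely \<open>map g u\<close>. This identifies the
  swap and both counits, given as pullbacks of coefficients, with homomorphisms.\<close>

lemma lookup_evh_letters:
  assumes \<phi>: "\<And>l. \<phi> l = (if P l then Poly_Mapping.single [f l] 1 else 0)"
    and P: "\<And>l. P l \<Longrightarrow> g (f l) = l \<and> Q (f l)"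
    and Q: "\<And>l. Q l \<Longrightarrow> f (g l) = l \<and> P (g l)"
  shows "lookup (evh scal \<phi> x) u = (if \<forall>l\<in>set u. Q l then lookup x (map g u) else 0)"
proof -
  have w: "prod_list (map \<phi> w) = (if \<forall>l\<in>set w. P l then Poly_Mapping.single (map f w) 1 else 0)" for w
  proof (induction w)
    case Nil then show ?case by (simp add: single_one[symmetric] zero_list_def del: single_one)
  next
    case (Cons l w) then show ?case by (auto simp: \<phi> mult_single plus_list_def)
  qed
  have eq: "(\<forall>l\<in>set w. P l) \<and> map f w = u \<longleftrightarrow> (\<forall>l\<in>set u. Q l) \<and> w = map g u" for w
    by (auto simp: P Q map_idI)
  have "lookup (evh scal \<phi> x) u =
      (\<Sum>w\<in>keys x. lookup x w * (if (\<forall>l\<in>set w. P l) \<and> map f w = u then 1 else 0))"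
    unfolding evh_def lookup_sum lookup_scal_times fsc_def
    by (rule sum.cong) (auto simp: w lookup_single when_def)
  also have "\<dots> = (if \<forall>l\<in>set u. Q l then lookup x (map g u) else 0)"
    unfolding eq
  proof (cases "\<forall>l\<in>set u. Q l")
    case True
    then show "(\<Sum>w\<in>keys x. lookup x w * (if (\<forall>l\<in>set u. Q l) \<and> w = map g u then 1 else 0)) =
        (if \<forall>l\<in>set u. Q l then lookup x (map g u) else 0)"
      by (simp add: in_keys_iff if_distrib[of "\<lambda>c. _ * c"] cong: if_cong)
  next
    case False
    then show "(\<Sum>w\<in>keys x. lookup x w * (if (\<forall>l\<in>set u. Q l) \<and> w = map g u then 1 else 0)) =
        (if \<forall>l\<in>set u. Q l then lookup x (map g u) else 0)"
      by (simp only: simp_thms if_False mult_zero_right sum.neutral_const)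
  qed
  finally show ?thesis .
qed

definition TF :: "falg \<Rightarrow> falg" where
  "TF = evh scal (\<lambda>(j,m,n). gn (if j = 0 then 1 else if j = 1 then 0 else j) m n)"
definition cIdF :: "falg \<Rightarrow> falg" where
  "cIdF = evh scal (\<lambda>(j,m,n). if j = 1 then gn 0 m n else 0)"
definition IdcF :: "falg \<Rightarrow> falg" where
  "IdcF = evh scal (\<lambda>(j,m,n). if j = 0 then gn 0 m n else 0)"

lemma Tsw_lookup: "Tsw (lookup x) = lookup (TF x)"
proof
  fix u show "Tsw (lookup x) u = lookup (TF x) u"
    unfolding TF_def Tsw_def
    by (subst lookup_evh_letters[where P = "\<lambda>_. True" and Q = "\<lambda>_. True" and f = swl and g = swl])
      (auto simp: swl_def gn_def)
qed

lemma cId_lookup: "cId (lookup x) = lookup (cIdF x)"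
proof
  fix u show "cId (lookup x) u = lookup (cIdF x) u"
    unfolding cIdF_def cId_def
    by (subst lookup_evh_letters[where P = "\<lambda>l. fst l = 1" and Q = "\<lambda>l. fst l = 0"
          and f = "\<lambda>(j,m,n). (0,m,n)" and g = "\<lambda>(j,m,n). (1,m,n)"])
      (auto simp: gn_def)
qed

lemma Idc_lookup: "Idc (lookup x) = lookup (IdcF x)"
proof
  fix u show "Idc (lookup x) u = lookup (IdcF x) u"
    unfolding IdcF_def Idc_def
    by (subst lookup_evh_letters[where P = "\<lambda>l. fst l = 0" and Q = "\<lambda>l. fst l = 0"
          and f = "\<lambda>l. l" and g = "\<lambda>l. l"])
      (auto simp: gn_def)
qed

lemma alg_homs:
  "alg_hom fscal (YF s3)" "alg_hom fscal (IdYF s3)" "alg_hom fscal (YIdF s3)"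
  "alg_hom scal TF" "alg_hom scal cIdF" "alg_hom scal IdcF"
  unfolding YF_def IdYF_def YIdF_def TF_def cIdF_def IdcF_def
  by (intro scalars.alg_hom_evh scalars_fscal scalars_scal)+

lemma gn_images:
  "YF s3 (gn j m n) = DlF s3 0 1 m n"
  "IdYF s3 (gn j m n) = (if j = 0 then fls_const (gn 0 m n) else DlF s3 1 2 m n)"
  "YIdF s3 (gn j m n) = (if j = 0 then DlF s3 0 1 m n else fls_const (gn 2 m n))"
  "TF (gn j m n) = gn (if j = 0 then 1 else if j = 1 then 0 else j) m n"
  "cIdF (gn j m n) = (if j = 1 then gn 0 m n else 0)"
  "IdcF (gn j m n) = (if j = 0 then gn 0 m n else 0)"
  unfolding YF_def IdYF_def YIdF_def TF_def cIdF_def IdcF_def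
  by (subst scalars.evh_gn[OF scalars_fscal] scalars.evh_gn[OF scalars_scal]; simp)+

subsection \<open>The two-sided ideal of relations\<close>

locale ideal2 =
  fixes I :: "'a::ring_1 set"
  assumes zero [simp, intro]: "0 \<in> I"
    and add: "x \<in> I \<Longrightarrow> y \<in> I \<Longrightarrow> x + y \<in> I"
    and mult: "x \<in> I \<Longrightarrow> a * (x * b) \<in> I"
begin

lemma mult_left: "x \<in> I \<Longrightarrow> a * x \<in> I" using mult[of x a 1] by simp
lemma mult_right: "x \<in> I \<Longrightarrow> x * a \<in> I" using mult[of x 1 a] by simp
lemma uminus: "x \<in> I \<Longrightarrow> - x \<in> I" using mult_left[of x "- 1"] by simp
lemma diff: "x \<in> I \<Longrightarrow> y \<in> I \<Longrightarrow> x - y \<in> I" using add[of x "- y"] uminus[of y] by simp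
lemma sum: "(\<And>i. i \<in> S \<Longrightarrow> f i \<in> I) \<Longrightarrow> sum f S \<in> I"
  by (induction S rule: infinite_finite_induct) (auto intro: add)

end

definition idF :: "complex \<Rightarrow> complex \<Rightarrow> nat \<Rightarrow> falg set" where
  "idF s2 s3 K = {x. lookup x \<in> idl s2 s3 K}"

lemma eqv_lookup: "eqv s2 s3 K (lookup x) (lookup y) \<longleftrightarrow> x - y \<in> idF s2 s3 K"
  by (simp add: eqv_def idF_def lookup_diff)

lemma ideal2_idF: "ideal2 (idF s2 s3 K)"
  by unfold_locales
    (auto simp: idF_def lookup_0 lookup_plus lookup_times intro: idl.intros)

lemma idF_t20:
  assumes "j < K"
  shows "gn j 2 0 * gn j c d - gn j c d * gn j 2 0 - scal (2 * of_nat d) * gn j (c+1) (d-1) \<in> idF s2 s3 K"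
  unfolding idF_def mem_Collect_eq lookup_diff lookup_scal_times lookup_fcomm lookup_gn
  using assms unfolding lookup_times fcomm_def[symmetric] lookup_gn
  by (intro idl.gen) (auto simp: rels_def rel_copy_def)

lemma idF_comm:
  assumes "i < K" "j < K" "i \<noteq> j"
  shows "gn i m n * gn j m' n' - gn j m' n' * gn i m n \<in> idF s2 s3 K"
  unfolding idF_def mem_Collect_eq lookup_fcomm lookup_gn
proof (rule idl.gen)
  show "fcomm (tg i m n) (tg j m' n') \<in> rels s2 s3 K"
    unfolding rels_def by (intro UnI2 CollectI exI conjI) (rule refl assms)+
qed

subsection \<open>Monomials in three expansions\<close>

lemma gbin_of_nat: "gbin (int n) k = of_nat (n choose k)"
  unfolding gbin_def binomial_gbinomial by simp

lemma gbin_0 [simp]: "gbin c 0 = 1"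
  by (simp add: gbin_def)

lemma gbin_negated: "gbin a k = (-1)^k * gbin (int k - a - 1) k"
  unfolding gbin_def by (subst gbinomial_negated_upper) simp

lemma gbin_Vandermonde: "(\<Sum>k\<le>n. gbin a k * gbin b (n - k)) = gbin (a + b) n"
  using gbinomial_Vandermonde[of "of_int a :: complex" "of_int b" n]
  by (simp add: gbin_def atMost_atLeast0)

text \<open>The three residues, at \<open>w\<^sub>2 / w\<^sub>1 = 0, \<infinity>, 1\<close>, of a monomial form on the projective line add up to zero.\<close>

lemma residue_sum:
  "(if 0 \<le> b then gbin (a + b) (nat b) * (-1)^nat b else 0)
    - (if 0 \<le> a then (-1) powi (a + b) * (gbin (a + b) (nat a) * (-1)^nat a) else 0)
   = (if a + b < 0 then gbin (- a - 1) (nat (- a - b - 1)) else 0)"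
proof -
  have zero: "gbin x (nat y) = 0" if "0 \<le> x" "x < y" for x y
    using gbin_of_nat[of "nat x" "nat y"] that by (simp add: nat_less_eq_zless)
  \<comment> \<open>Negating the upper index turns the left side into \<open>n choose k\<close>, and
    the right side is \<open>n choose (n - k)\<close>.\<close>
  have in_ideal_above: "gbin (a + b) (nat b) * (-1)^nat b = gbin (- a - 1) (nat (- a - b - 1))"
    if "0 \<le> b" "a + b < 0" for a b
  proof -
    define n k where "n = nat (- a - 1)" and "k = nat b"
    have nk: "a = - 1 - int n" "b = int k" "k \<le> n" using that by (auto simp: n_def k_def)
    have "gbin (a + b) k * (-1)^k = gbin (int n) k"
      by (subst gbin_negated) (simp add: nk)
    moreover have "nat (- a - b - 1) = n - k" using nk by auto
    ultimately show ?thesis using nk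
      by (simp add: gbin_of_nat binomial_symmetric[of k n])
  qed
  \<comment> \<open>The form is z^(-b-1) (1 - z)^(a+b) dz with z = w2 / w1. In each sign quadrant at
    least one residue is absent by its own condition; \<open>zero\<close> removes binomials whose
    lower index exceeds a nonnegative upper one, and reflection matches what is left.\<close>
  consider "0 \<le> a" "0 \<le> b" | "0 \<le> b" "a < 0" | "0 \<le> a" "b < 0" | "a < 0" "b < 0" by linarith
  then show ?thesis
  proof cases
    case 1
    define m n where "m = nat a" and "n = nat b"
    have mn: "a = int m" "b = int n" using 1 by (auto simp: m_def n_def)
    have "gbin (int m + int n) m = gbin (int m + int n) n"
      using gbin_of_nat[of "m + n"] by (simp add: binomial_symmetric[of m "m + n"])
    then show ?thesis
      unfolding mn using power_int_of_nat[of "-1::complex" "m + n"]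
      by (simp add: power_add minus_one_power_iff)
  next
    case 2
    then show ?thesis using zero[of "a + b" b] in_ideal_above[of b a] by auto
  next
    case 3
    show ?thesis
    proof (cases "a + b < 0")
      case True
      define n k where "n = nat (- b - 1)" and "k = nat a"
      have nk: "b = - 1 - int n" "a = int k" "k \<le> n" using 3 True by (auto simp: n_def k_def)
      have e: "nat (- a - b - 1) = n - k" using nk by auto
      have "gbin (- a - 1) (n - k) = (-1)^(n - k) * gbin (int n) (n - k)"
        using gbin_negated[of "- a - 1" "n - k"] nk by (simp add: of_nat_diff)
      also have "\<dots> = (-1)^(n - k) * gbin (int n) k"
        using nk by (simp add: gbin_of_nat binomial_symmetric[of k n])
      finally have r: "gbin (- a - 1) (n - k) = (-1)^(n - k) * gbin (int n) k" .
      have l: "gbin (a + b) k * (-1)^k = gbin (int n) k"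
        by (subst gbin_negated) (simp add: nk)
      have "a + b = - int (Suc (n - k))" using nk by auto
      then have s: "((-1::complex) powi (a + b)) = - ((-1)^(n - k))"
        by (simp only: power_int_minus power_int_of_nat) (simp add: minus_one_power_iff)
      have "nat a = k" by (simp add: nk)
      then show ?thesis using True 3 by (simp add: e r l s)
    next
      case False
      then show ?thesis using 3 zero[of "a + b" a] by auto
    qed
  next
    case 4
    then show ?thesis using zero[of "- a - 1" "- a - b - 1"] by auto
  qed
qed

abbreviation const2 :: "falg \<Rightarrow> falg fls fls" where "const2 x \<equiv> fls_const (fls_const x)"

text \<open>\<open>X\<^sup>a Y\<^sup>b (X + \<epsilon> Y)\<^sup>c\<close> expanded for \<open>|X| > |Y|\<close>, where the outer variable of the series is
  \<open>1 / X\<close> and the inner one is \<open>1 / Y\<close>.\<close>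

definition expansion :: "complex \<Rightarrow> int \<Rightarrow> int \<Rightarrow> int \<Rightarrow> falg fls fls" where
  "expansion \<epsilon> a b c = Abs_fls (\<lambda>i. if - (a + c) \<le> i then
     fls_shift (a + b + c + i) (fls_const (scal (gbin c (nat (i + a + c)) * \<epsilon> ^ nat (i + a + c)))) else 0)"

lemma expansion_nth: "expansion \<epsilon> a b c $$ i = (if - (a + c) \<le> i then
     fls_shift (a + b + c + i) (fls_const (scal (gbin c (nat (i + a + c)) * \<epsilon> ^ nat (i + a + c)))) else 0)"
  unfolding expansion_def by (rule nth_Abs_fls_ex_lower_bound) (auto intro: exI[of _ "- (a + c)"])

lemma expansion_nth_nth: "expansion \<epsilon> a b c $$ i $$ j =
   (if - (a + c) \<le> i \<and> i + j = - (a + b + c) then scal (gbin c (nat (i + a + c)) * \<epsilon> ^ nat (i + a + c)) else 0)"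
  by (auto simp: expansion_nth)

lemma expansion_0: "expansion \<epsilon> 0 0 0 = 1"
proof (rule fls_eqI, rule fls_eqI)
  fix i j
  show "expansion \<epsilon> 0 0 0 $$ i $$ j = (1 :: falg fls fls) $$ i $$ j"
    by (auto simp: expansion_nth_nth gbin_def gbinomial_0_left)
qed

lemma fls_const_sum: "fls_const (sum f S) = (\<Sum>i\<in>S. fls_const (f i))"
  by (rule fls_eqI) (simp add: fls_nth_sum)

lemma scal_sum: "scal (sum f S) = (\<Sum>i\<in>S. scal (f i))"
  by (induction S rule: infinite_finite_induct) (simp_all add: scal_add)

lemma fls_shift_sum: "fls_shift n (sum f S) = (\<Sum>i\<in>S. fls_shift n (f i))"
  by (rule fls_eqI) (simp add: fls_nth_sum)

text \<open>By homogeneity each outer coefficient is a single inner monomial whose exponent is fixed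
  by the total degree. The convolution is therefore a scalar sum, evaluated by Vandermonde.\<close>

lemma expansion_mult: "expansion \<epsilon> a b c * expansion \<epsilon> a' b' c' = expansion \<epsilon> (a + a') (b + b') (c + c')"
proof (rule fls_eqI)
  fix i
  let ?k = "\<lambda>c n. gbin c n * \<epsilon> ^ n"
  let ?N = "nat (i + a + a' + c + c')"
  have "(expansion \<epsilon> a b c * expansion \<epsilon> a' b' c') $$ i =
     (\<Sum>l = - (a + c)..i - (- (a' + c')). expansion \<epsilon> a b c $$ l * expansion \<epsilon> a' b' c' $$ (i - l))"
    by (rule fls_nth_times_bound) (auto simp: expansion_nth)
  also have "\<dots> = (\<Sum>l = - (a + c)..i - (- (a' + c')).
      fls_shift (a + b + c + a' + b' + c' + i)
        (fls_const (scal (?k c (nat (l + a + c)) * ?k c' (nat (i - l + a' + c'))))))"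
    by (rule sum.cong) (auto simp: expansion_nth fls_shifted_times_simps scal_mult algebra_simps)
  also have "\<dots> = fls_shift (a + b + c + a' + b' + c' + i) (fls_const (scal
      (\<Sum>l = - (a + c)..i - (- (a' + c')). ?k c (nat (l + a + c)) * ?k c' (nat (i - l + a' + c')))))"
    by (simp only: scal_sum fls_const_sum fls_shift_sum)
  also have "(\<Sum>l = - (a + c)..i - (- (a' + c')). ?k c (nat (l + a + c)) * ?k c' (nat (i - l + a' + c')))
     = (if - (a + a' + (c + c')) \<le> i then ?k (c + c') ?N else 0)"
  proof (cases "- (a + a' + (c + c')) \<le> i")
    case True
    have "(\<Sum>l = - (a + c)..i - (- (a' + c')). ?k c (nat (l + a + c)) * ?k c' (nat (i - l + a' + c')))
        = (\<Sum>k\<le>?N. ?k c k * ?k c' (?N - k))"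
      by (rule sum.reindex_bij_witness[of _ "\<lambda>k. int k - (a + c)" "\<lambda>l. nat (l + a + c)"])
        (use True in \<open>auto simp: nat_diff_distrib[symmetric] algebra_simps intro!: arg_cong2[of _ _ _ _ "\<lambda>x y. gbin x y * _ ^ y"]\<close>)
    also have "\<dots> = (\<Sum>k\<le>?N. gbin c k * gbin c' (?N - k)) * \<epsilon> ^ ?N"
      unfolding sum_distrib_right by (rule sum.cong) (auto simp: power_add[symmetric])
    finally show ?thesis using True by (simp add: gbin_Vandermonde)
  qed auto
  finally show "(expansion \<epsilon> a b c * expansion \<epsilon> a' b' c') $$ i = expansion \<epsilon> (a + a') (b + b') (c + c') $$ i"
    by (simp add: expansion_nth algebra_simps)
qed

lemma expansion_central: "expansion \<epsilon> a b c * const2 x = const2 x * expansion \<epsilon> a b c"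
  by (rule fls_eqI, rule fls_eqI) (simp add: expansion_nth_nth scal_comm)

text \<open>\<open>w\<^sub>1\<^sup>\<alpha> w\<^sub>2\<^sup>\<beta> (w\<^sub>1 - w\<^sub>2)\<^sup>\<gamma>\<close> with (outer, inner) variables \<open>(w\<^sub>1, w\<^sub>2)\<close>, \<open>(w\<^sub>2, w\<^sub>1)\<close> and \<open>(w\<^sub>2, w\<^sub>0)\<close>,
  where \<open>w\<^sub>1 = w\<^sub>2 + w\<^sub>0\<close>.\<close>

definition mono1 :: "int \<Rightarrow> int \<Rightarrow> int \<Rightarrow> falg fls fls" where
  "mono1 \<alpha> \<beta> \<gamma> = expansion (-1) \<alpha> \<beta> \<gamma>"
definition mono2 :: "int \<Rightarrow> int \<Rightarrow> int \<Rightarrow> falg fls fls" where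
  "mono2 \<alpha> \<beta> \<gamma> = const2 (scal ((-1) powi \<gamma>)) * expansion (-1) \<beta> \<alpha> \<gamma>"
definition mono3 :: "int \<Rightarrow> int \<Rightarrow> int \<Rightarrow> falg fls fls" where
  "mono3 \<alpha> \<beta> \<gamma> = expansion 1 \<beta> \<gamma> \<alpha>"

lemma const2_mult: "const2 x * const2 y = const2 (x * y)"
  by simp

lemma mono_mult:
  "(const2 x * mono1 \<alpha> \<beta> \<gamma>) * (const2 y * mono1 \<alpha>' \<beta>' \<gamma>') = const2 (x * y) * mono1 (\<alpha> + \<alpha>') (\<beta> + \<beta>') (\<gamma> + \<gamma>')"
  "(const2 x * mono2 \<alpha> \<beta> \<gamma>) * (const2 y * mono2 \<alpha>' \<beta>' \<gamma>') = const2 (x * y) * mono2 (\<alpha> + \<alpha>') (\<beta> + \<beta>') (\<gamma> + \<gamma>')"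
  "(const2 x * mono3 \<alpha> \<beta> \<gamma>) * (const2 y * mono3 \<alpha>' \<beta>' \<gamma>') = const2 (x * y) * mono3 (\<alpha> + \<alpha>') (\<beta> + \<beta>') (\<gamma> + \<gamma>')"
proof -
  have E: "(const2 x * expansion \<epsilon> a b c) * (const2 y * expansion \<epsilon> a' b' c') = const2 (x * y) * expansion \<epsilon> (a + a') (b + b') (c + c')"
    for \<epsilon> a b c a' b' c' x y
  proof -
    have "(const2 x * expansion \<epsilon> a b c) * (const2 y * expansion \<epsilon> a' b' c') = const2 x * (expansion \<epsilon> a b c * const2 y) * expansion \<epsilon> a' b' c'"
      by (simp only: mult.assoc)
    also have "\<dots> = const2 x * const2 y * (expansion \<epsilon> a b c * expansion \<epsilon> a' b' c')"
      by (simp only: expansion_central mult.assoc)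
    finally show ?thesis by (simp only: expansion_mult const2_mult)
  qed
  show "(const2 x * mono1 \<alpha> \<beta> \<gamma>) * (const2 y * mono1 \<alpha>' \<beta>' \<gamma>') = const2 (x * y) * mono1 (\<alpha> + \<alpha>') (\<beta> + \<beta>') (\<gamma> + \<gamma>')"
    and "(const2 x * mono3 \<alpha> \<beta> \<gamma>) * (const2 y * mono3 \<alpha>' \<beta>' \<gamma>') = const2 (x * y) * mono3 (\<alpha> + \<alpha>') (\<beta> + \<beta>') (\<gamma> + \<gamma>')"
    by (simp_all only: mono1_def mono3_def E)
  \<comment> \<open>The sign from (w1 - w2)^\<gamma> = (-1)^\<gamma> (w2 - w1)^\<gamma> is absorbed
    into the constant; it is multiplicative in \<gamma>.\<close>
  have cx: "const2 x * mono2 \<alpha> \<beta> \<gamma> = const2 (scal ((-1) powi \<gamma>) * x) * expansion (-1) \<beta> \<alpha> \<gamma>" for x \<alpha> \<beta> \<gamma>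
    by (simp only: mono2_def mult.assoc[symmetric] const2_mult scal_comm)
  have "scal a * x * (scal b * y) = scal (a * b) * (x * y)" for a b
    by (simp only: mult.assoc scal_left_comm[of x _ y] scal_mult)
  then show "(const2 x * mono2 \<alpha> \<beta> \<gamma>) * (const2 y * mono2 \<alpha>' \<beta>' \<gamma>') = const2 (x * y) * mono2 (\<alpha> + \<alpha>') (\<beta> + \<beta>') (\<gamma> + \<gamma>')"
    by (simp only: cx E) (simp add: power_int_add)
qed

subsection \<open>The residue functionals\<close>

text \<open>The common shape of the three Jacobi terms: a weighted sum along the antidiagonal of
  total degree \<open>P + Q\<close>, with growing outer exponent, hence with finitely many nonzero
  terms.\<close>

definition res :: "(nat \<Rightarrow> complex) \<Rightarrow> int \<Rightarrow> int \<Rightarrow> falg fls fls \<Rightarrow> falg" where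
  "res \<kappa> P Q s = (\<Sum>m. scal (\<kappa> m) * s $$ (- (P + int m)) $$ (- (Q - int m)))"

text \<open>\<open>Sum_any\<close> is additive only for finite supports. Since every larger cutoff
  also works, two series can share one, and \<open>res_add\<close> becomes a statement about finite
  sums.\<close>

lemma res_finite: "\<exists>N. \<forall>M\<ge>N. \<forall>\<kappa> Q. res \<kappa> P Q s = (\<Sum>m<M. scal (\<kappa> m) * s $$ (- (P + int m)) $$ (- (Q - int m)))"
proof -
  obtain a where a: "\<And>i. i < a \<Longrightarrow> s $$ i = 0" using fls_bounded_below by metis
  have "res \<kappa> P Q s = (\<Sum>m<M. scal (\<kappa> m) * s $$ (- (P + int m)) $$ (- (Q - int m)))"
    if "nat (1 - a - P) \<le> M" for M \<kappa> Q
    unfolding res_def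
  proof (rule Sum_any.expand_superset)
    show "{m. scal (\<kappa> m) * s $$ (- (P + int m)) $$ (- (Q - int m)) \<noteq> 0} \<subseteq> {..<M}"
    proof
      fix m assume "m \<in> {m. scal (\<kappa> m) * s $$ (- (P + int m)) $$ (- (Q - int m)) \<noteq> 0}"
      then have "s $$ (- (P + int m)) \<noteq> 0" by auto
      then have "\<not> - (P + int m) < a" using a by blast
      then show "m \<in> {..<M}" using that by auto
    qed
  qed simp
  then show ?thesis by blast
qed

lemma res_add: "res \<kappa> P Q (s + t) = res \<kappa> P Q s + res \<kappa> P Q t"
proof -
  obtain N1 where N1: "\<forall>M\<ge>N1. \<forall>\<kappa> Q. res \<kappa> P Q (s + t) = (\<Sum>m<M. scal (\<kappa> m) * (s + t) $$ (- (P + int m)) $$ (- (Q - int m)))"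
    using res_finite by blast
  obtain N2 where N2: "\<forall>M\<ge>N2. \<forall>\<kappa> Q. res \<kappa> P Q s = (\<Sum>m<M. scal (\<kappa> m) * s $$ (- (P + int m)) $$ (- (Q - int m)))"
    using res_finite by blast
  obtain N3 where N3: "\<forall>M\<ge>N3. \<forall>\<kappa> Q. res \<kappa> P Q t = (\<Sum>m<M. scal (\<kappa> m) * t $$ (- (P + int m)) $$ (- (Q - int m)))"
    using res_finite by blast
  let ?M = "max N1 (max N2 N3)"
  show ?thesis
    using N1[rule_format, of ?M \<kappa> Q] N2[rule_format, of ?M \<kappa> Q] N3[rule_format, of ?M \<kappa> Q]
    by (simp add: distrib_left sum.distrib)
qed

lemma scal_sandwich: "scal a * (x * scal b) = scal (a * b) * x"
  by (simp only: scal_mult mult.assoc scal_comm[of b x])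

text \<open>The weights are the coefficients of (X + \<epsilon> Y)^k, so the sum reads a coefficient
  of the product with this kernel; Vandermonde merges the exponents into
  \<open>k + c\<close>.\<close>

lemma res_expansion:
  assumes "\<And>m. \<kappa> m = sg * (gbin k m * \<epsilon> ^ m)"
  shows "res \<kappa> P Q (const2 x * expansion \<epsilon> a b c) =
    (if P + Q = a + b + c \<and> b \<le> Q then scal (sg * (gbin (k + c) (nat (Q - b)) * \<epsilon> ^ nat (Q - b))) * x else 0)"
proof -
  let ?n = "nat (Q - b)"
  have t: "scal (\<kappa> m) * (const2 x * expansion \<epsilon> a b c) $$ (- (P + int m)) $$ (- (Q - int m)) =
     (if P + Q = a + b + c \<and> b \<le> Q \<and> m \<le> ?n then
       scal (sg * (gbin k m * gbin c (?n - m)) * \<epsilon> ^ ?n) * x else 0)" for m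
  proof (cases "P + Q = a + b + c \<and> b \<le> Q \<and> m \<le> ?n")
    case True
    then have e: "nat (- (P + int m) + a + c) = ?n - m" and le: "- (a + c) \<le> - (P + int m)" by auto
    have p: "\<epsilon> ^ m * \<epsilon> ^ (?n - m) = \<epsilon> ^ ?n"
      using True by (simp add: power_add[symmetric])
    have q: "sg * (gbin k m * \<epsilon> ^ m) * (gbin c (?n - m) * \<epsilon> ^ (?n - m)) =
        sg * (gbin k m * gbin c (?n - m)) * (\<epsilon> ^ m * \<epsilon> ^ (?n - m))"
      by (simp only: ac_simps)
    have "scal (\<kappa> m) * (const2 x * expansion \<epsilon> a b c) $$ (- (P + int m)) $$ (- (Q - int m)) =
      scal (\<kappa> m) * (x * scal (gbin c (?n - m) * \<epsilon> ^ (?n - m)))"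
      unfolding fls_mult_const_nth expansion_nth_nth e using True le by simp
    also have "\<dots> = scal (\<kappa> m * (gbin c (?n - m) * \<epsilon> ^ (?n - m))) * x"
      by (rule scal_sandwich)
    finally show ?thesis using True by (simp only: assms q p) simp
  next
    case False
    then show ?thesis by (auto simp: expansion_nth_nth)
  qed
  have "res \<kappa> P Q (const2 x * expansion \<epsilon> a b c) = (\<Sum>m\<le>?n. if P + Q = a + b + c \<and> b \<le> Q then
       scal (sg * (gbin k m * gbin c (?n - m)) * \<epsilon> ^ ?n) * x else 0)"
    unfolding res_def t
    by (subst Sum_any.expand_superset[of "{..?n}"]) (auto intro!: sum.cong split: if_splits)
  also have "\<dots> = (if P + Q = a + b + c \<and> b \<le> Q then
       scal (sg * (\<Sum>m\<le>?n. gbin k m * gbin c (?n - m)) * \<epsilon> ^ ?n) * x else 0)"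
    by (cases "P + Q = a + b + c \<and> b \<le> Q")
      (simp_all only: simp_thms if_True if_False sum.neutral_const scal_sum sum_distrib_left sum_distrib_right)
  finally show ?thesis by (simp add: gbin_Vandermonde mult.assoc)
qed

definition jac1 :: "int \<Rightarrow> int \<Rightarrow> int \<Rightarrow> falg fls fls \<Rightarrow> falg" where
  "jac1 i0 i1 i2 = res (\<lambda>m. gbin (- i0 - 1) m * (-1) ^ m) (i1 + i0 + 1) i2"
definition jac2 :: "int \<Rightarrow> int \<Rightarrow> int \<Rightarrow> falg fls fls \<Rightarrow> falg" where
  "jac2 i0 i1 i2 = res (\<lambda>m. gbin (- i0 - 1) m * (-1) powi (- i0 - 1 + int m)) (i2 + i0 + 1) i1"
definition jac3 :: "int \<Rightarrow> int \<Rightarrow> int \<Rightarrow> falg fls fls \<Rightarrow> falg" where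
  "jac3 i0 i1 i2 = res (\<lambda>m. gbin (i1 + int m) m * (-1) ^ m) (i2 + i1 + 1) i0"

lemma J1_lookup: "J1 (\<lambda>a b. lookup (s $$ (- a) $$ (- b))) i0 i1 i2 = lookup (jac1 i0 i1 i2 s)"
  by (simp add: J1_def jac1_def res_def lookup_scal_times[symmetric] lookup_fsum algebra_simps)

lemma J2_lookup: "J2 (\<lambda>a b. lookup (s $$ (- b) $$ (- a))) i0 i1 i2 = lookup (jac2 i0 i1 i2 s)"
  by (simp add: J2_def jac2_def res_def lookup_scal_times[symmetric] lookup_fsum algebra_simps)

lemma J3_lookup: "J3 (\<lambda>a b. lookup (s $$ (- b) $$ (- a))) i0 i1 i2 = lookup (jac3 i0 i1 i2 s)"
  by (simp add: J3_def jac3_def res_def lookup_scal_times[symmetric] lookup_fsum algebra_simps)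

lemma jacobi_mono:
  "jac1 i0 i1 i2 (const2 x * mono1 \<alpha> \<beta> \<gamma>) - jac2 i0 i1 i2 (const2 x * mono2 \<alpha> \<beta> \<gamma>) = jac3 i0 i1 i2 (const2 x * mono3 \<alpha> \<beta> \<gamma>)"
proof -
  \<comment> \<open>With these shifts the three terms are exactly those of
    \<open>residue_sum\<close> when the total degrees match; otherwise all three vanish.\<close>
  define a b where "a = i1 - \<alpha>" and "b = i2 - \<beta>"
  let ?D = "i0 + i1 + i2 + 1 = \<alpha> + \<beta> + \<gamma>"
  have c: "\<gamma> - i0 - 1 = a + b" if ?D using that by (simp add: a_def b_def)
  have k1: "jac1 i0 i1 i2 (const2 x * mono1 \<alpha> \<beta> \<gamma>) =
      (if ?D \<and> 0 \<le> b then scal (gbin (\<gamma> - i0 - 1) (nat b) * (-1) ^ nat b) * x else 0)"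
    unfolding jac1_def mono1_def
    by (subst res_expansion[where sg = 1 and k = "- i0 - 1"]) (auto simp: b_def algebra_simps)
  have cx: "const2 x * mono2 \<alpha> \<beta> \<gamma> = const2 (scal ((-1) powi \<gamma>) * x) * expansion (-1) \<beta> \<alpha> \<gamma>"
    by (simp only: mono2_def mult.assoc[symmetric] const2_mult scal_comm)
  have s: "(-1) powi (- i0 - 1) * (-1) powi \<gamma> = ((-1) powi (\<gamma> - i0 - 1) :: complex)"
    by (subst power_int_add[symmetric]) (auto simp: algebra_simps)
  have kk: "gbin (- i0 - 1) m * (-1) powi (- i0 - 1 + int m) =
      (-1) powi (- i0 - 1) * (gbin (- i0 - 1) m * (-1) ^ m)" for m
    by (subst power_int_add) simp_all
  have "jac2 i0 i1 i2 (const2 x * mono2 \<alpha> \<beta> \<gamma>) =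
      (if ?D \<and> 0 \<le> a then scal ((-1) powi (- i0 - 1) * (gbin (\<gamma> - i0 - 1) (nat a) * (-1) ^ nat a)) *
        (scal ((-1) powi \<gamma>) * x) else 0)"
    unfolding jac2_def cx by (subst res_expansion[OF kk]) (auto simp: a_def algebra_simps)
  then have k2: "jac2 i0 i1 i2 (const2 x * mono2 \<alpha> \<beta> \<gamma>) =
      (if ?D \<and> 0 \<le> a then scal ((-1) powi (\<gamma> - i0 - 1) * (gbin (\<gamma> - i0 - 1) (nat a) * (-1) ^ nat a)) * x else 0)"
    unfolding s[symmetric] by (simp only: mult.assoc[symmetric] scal_mult[symmetric]) (simp only: ac_simps)
  \<comment> \<open>Negating the upper index exhibits the weights of \<open>jac3\<close> as the
    coefficients of (w2 + w0)^(-i1-1).\<close>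
  have g: "gbin (i1 + int m) m * (-1) ^ m = 1 * (gbin (- i1 - 1) m * 1 ^ m)" for m
    by (subst gbin_negated) (simp add: algebra_simps)
  have k3: "jac3 i0 i1 i2 (const2 x * mono3 \<alpha> \<beta> \<gamma>) =
      (if ?D \<and> \<gamma> \<le> i0 then scal (gbin (\<alpha> - i1 - 1) (nat (i0 - \<gamma>))) * x else 0)"
    unfolding jac3_def mono3_def
    by (subst res_expansion[OF g]) (auto simp: algebra_simps)
  show ?thesis
  proof (cases ?D)
    case True
    have e: "\<gamma> \<le> i0 \<longleftrightarrow> a + b < 0" "nat (i0 - \<gamma>) = nat (- a - b - 1)" "\<alpha> - i1 - 1 = - a - 1"
      using True by (auto simp: a_def b_def)
    have d: "scal (p - q) = scal p - scal q" for p q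
      using scal_add[of p "- q"] by (simp add: scal_uminus)
    have "jac1 i0 i1 i2 (const2 x * mono1 \<alpha> \<beta> \<gamma>) - jac2 i0 i1 i2 (const2 x * mono2 \<alpha> \<beta> \<gamma>) =
       scal ((if 0 \<le> b then gbin (a + b) (nat b) * (-1)^nat b else 0)
    - (if 0 \<le> a then (-1) powi (a + b) * (gbin (a + b) (nat a) * (-1)^nat a) else 0)) * x"
      unfolding k1 k2 c[OF True] d using True by (auto simp: left_diff_distrib)
    also have "\<dots> = jac3 i0 i1 i2 (const2 x * mono3 \<alpha> \<beta> \<gamma>)"
      unfolding residue_sum k3 e using True by auto
    finally show ?thesis .
  qed (simp add: k1 k2 k3)
qed

subsection \<open>Compatible triples of expansions\<close>

text \<open>The bound \<open>B\<close> on the total degree is carried along because multiplying by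
  such an element shifts the precision of an approximation by \<open>B\<close>.\<close>

inductive laurent_triple :: "int \<Rightarrow> falg fls fls \<Rightarrow> falg fls fls \<Rightarrow> falg fls fls \<Rightarrow> bool" for B where
  mono: "\<alpha> + \<beta> + \<gamma> \<le> B \<Longrightarrow> laurent_triple B (const2 x * mono1 \<alpha> \<beta> \<gamma>) (const2 x * mono2 \<alpha> \<beta> \<gamma>) (const2 x * mono3 \<alpha> \<beta> \<gamma>)"
| add: "laurent_triple B s1 s2 s3 \<Longrightarrow> laurent_triple B t1 t2 t3 \<Longrightarrow> laurent_triple B (s1 + t1) (s2 + t2) (s3 + t3)"

lemma laurent_triple_le: "laurent_triple B s1 s2 s3 \<Longrightarrow> B \<le> B' \<Longrightarrow> laurent_triple B' s1 s2 s3"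
  by (induction rule: laurent_triple.induct) (auto intro: laurent_triple.intros)

lemma laurent_triple_zero: "laurent_triple B 0 0 0"
  using laurent_triple.mono[of B 0 0 B 0] by simp

lemma laurent_triple_sum:
  assumes "\<And>k. k \<in> S \<Longrightarrow> laurent_triple B (f1 k) (f2 k) (f3 k)"
  shows "laurent_triple B (sum f1 S) (sum f2 S) (sum f3 S)"
  using assms by (induction S rule: infinite_finite_induct) (auto intro: laurent_triple_zero laurent_triple.add)

lemma laurent_triple_mult_mono:
  assumes "laurent_triple B' t1 t2 t3" "\<alpha> + \<beta> + \<gamma> \<le> B"
  shows "laurent_triple (B + B') (const2 x * mono1 \<alpha> \<beta> \<gamma> * t1) (const2 x * mono2 \<alpha> \<beta> \<gamma> * t2) (const2 x * mono3 \<alpha> \<beta> \<gamma> * t3)"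
  using assms
proof (induction rule: laurent_triple.induct)
  case (mono \<alpha>' \<beta>' \<gamma>' y)
  then show ?case unfolding mono_mult by (intro laurent_triple.mono) linarith
next
  case (add s1 s2 s3 t1 t2 t3)
  then show ?case by (simp only: distrib_left laurent_triple.add)
qed

lemma laurent_triple_mult:
  assumes "laurent_triple B s1 s2 s3" "laurent_triple B' t1 t2 t3"
  shows "laurent_triple (B + B') (s1 * t1) (s2 * t2) (s3 * t3)"
  using assms(1)
proof (induction rule: laurent_triple.induct)
  case (mono \<alpha> \<beta> \<gamma> x)
  then show ?case by (intro laurent_triple_mult_mono assms)
next
  case (add s1 s2 s3 t1 t2 t3)
  then show ?case by (simp only: distrib_right laurent_triple.add)
qed

lemma jac_add:
  "jac1 i0 i1 i2 (s + t) = jac1 i0 i1 i2 s + jac1 i0 i1 i2 t"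
  "jac2 i0 i1 i2 (s + t) = jac2 i0 i1 i2 s + jac2 i0 i1 i2 t"
  "jac3 i0 i1 i2 (s + t) = jac3 i0 i1 i2 s + jac3 i0 i1 i2 t"
  by (simp_all add: jac1_def jac2_def jac3_def res_add)

lemma jacobi_laurent_triple: "laurent_triple B s1 s2 s3 \<Longrightarrow> jac1 i0 i1 i2 s1 - jac2 i0 i1 i2 s2 = jac3 i0 i1 i2 s3"
proof (induction rule: laurent_triple.induct)
  case (mono \<alpha> \<beta> \<gamma> x) show ?case by (rule jacobi_mono)
next
  case (add s1 s2 s3 t1 t2 t3) then show ?case by (simp add: jac_add algebra_simps)
qed

text \<open>Indices count powers of the inverse variables, so \<open>- (i + j)\<close> is the total
  degree.\<close>

definition degree_le :: "int \<Rightarrow> falg fls fls \<Rightarrow> bool" where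
  "degree_le B s \<longleftrightarrow> (\<forall>i j. - (i + j) > B \<longrightarrow> s $$ i $$ j = 0)"

lemma degree_le_add: "degree_le B s \<Longrightarrow> degree_le B t \<Longrightarrow> degree_le B (s + t)"
  by (simp add: degree_le_def)

lemma degree_le_le: "degree_le B s \<Longrightarrow> B \<le> B' \<Longrightarrow> degree_le B' s"
  by (simp add: degree_le_def)

lemma degree_le_laurent_triple: "laurent_triple B s1 s2 s3 \<Longrightarrow> degree_le B s1 \<and> degree_le B s2 \<and> degree_le B s3"
proof (induction rule: laurent_triple.induct)
  case (mono \<alpha> \<beta> \<gamma> x) then show ?case by (auto simp: degree_le_def mono1_def mono2_def mono3_def expansion_nth_nth)
next
  case (add s1 s2 s3 t1 t2 t3) then show ?case by (auto intro: degree_le_add)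
qed


lemma degree_le_mult:
  assumes "degree_le B s" "degree_le B' t" shows "degree_le (B + B') (s * t)"
  unfolding degree_le_def
proof (intro allI impI)
  fix i j assume ij: "- (i + j) > B + B'"
  have "s $$ k $$ l * t $$ (i - k) $$ (j - l) = 0" for k l
  proof (cases "- (k + l) > B")
    case False
    then have "- ((i - k) + (j - l)) > B'" using ij by linarith
    then show ?thesis using assms(2) by (simp add: degree_le_def)
  qed (use assms(1) in \<open>simp add: degree_le_def\<close>)
  then show "(s * t) $$ i $$ j = 0"
    by (simp add: fls_times_nth(2) fls_nth_sum)
qed

context ideal2
begin

text \<open>A neighbourhood of zero in the completion by total degree, taken modulo the ideal:
  coefficients below degree \<open>D\<close> are unconstrained.\<close>

definition in_ideal_above :: "int \<Rightarrow> 'a fls fls \<Rightarrow> bool" where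
  "in_ideal_above D s \<longleftrightarrow> (\<forall>i j. - (i + j) \<ge> D \<longrightarrow> s $$ i $$ j \<in> I)"

end

locale ideal_falg = ideal2 I for I :: "falg set"
begin

lemma in_ideal_above_add: "in_ideal_above D s \<Longrightarrow> in_ideal_above D t \<Longrightarrow> in_ideal_above D (s + t)"
  by (simp add: in_ideal_above_def add)

text \<open>To reach degree \<open>D + B\<close>, a coefficient of \<open>s\<close> below degree
  \<open>D\<close> must meet a coefficient of \<open>t\<close> above degree \<open>B\<close>, and
  that one is zero.\<close>

lemma in_ideal_above_mult_right:
  assumes "in_ideal_above D s" "degree_le B t" shows "in_ideal_above (D + B) (s * t)"
  unfolding in_ideal_above_def
proof (intro allI impI)
  fix i j assume ij: "- (i + j) \<ge> D + B"
  have "s $$ k $$ l * t $$ (i - k) $$ (j - l) \<in> I" for k l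
  proof (cases "- (k + l) \<ge> D")
    case False
    then have "- ((i - k) + (j - l)) > B" using ij by linarith
    then show ?thesis using assms(2) by (simp add: degree_le_def)
  qed (use assms(1) in \<open>simp add: in_ideal_above_def mult_right\<close>)
  then show "(s * t) $$ i $$ j \<in> I"
    by (simp add: fls_times_nth(2) fls_nth_sum sum)
qed

lemma in_ideal_above_mult_left:
  assumes "in_ideal_above D s" "degree_le B t" shows "in_ideal_above (D + B) (t * s)"
  unfolding in_ideal_above_def
proof (intro allI impI)
  fix i j assume ij: "- (i + j) \<ge> D + B"
  have "t $$ k $$ l * s $$ (i - k) $$ (j - l) \<in> I" for k l
  proof (cases "- ((i - k) + (j - l)) \<ge> D")
    case False
    then have "- (k + l) > B" using ij by linarith
    then show ?thesis using assms(2) by (simp add: degree_le_def)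
  qed (use assms(1) in \<open>simp add: in_ideal_above_def mult_left\<close>)
  then show "(t * s) $$ i $$ j \<in> I"
    by (simp add: fls_times_nth(2) fls_nth_sum sum)
qed

lemma res_in_ideal: "in_ideal_above (P + Q) s \<Longrightarrow> res \<kappa> P Q s \<in> I"
  unfolding res_def Sum_any.expand_set
  by (rule sum, rule mult_left) (simp add: in_ideal_above_def)

text \<open>The bound \<open>B\<close> comes before the precision \<open>D\<close>: to approximate a
  product to precision \<open>D\<close>, each factor is approximated to \<open>D\<close> minus the
  bound of the other, so the bounds must not depend on the precision.\<close>

definition compat :: "falg fls fls \<Rightarrow> falg fls fls \<Rightarrow> falg fls fls \<Rightarrow> bool" where
  "compat s1 s2 s3 \<longleftrightarrow> (\<exists>B. degree_le B s1 \<and> degree_le B s2 \<and> degree_le B s3 \<and>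
     (\<forall>D. \<exists>l1 l2 l3. laurent_triple B l1 l2 l3 \<and> in_ideal_above D (s1 - l1) \<and> in_ideal_above D (s2 - l2) \<and> in_ideal_above D (s3 - l3)))"

lemma compat_laurent_triple: "laurent_triple B s1 s2 s3 \<Longrightarrow> compat s1 s2 s3"
  unfolding compat_def using degree_le_laurent_triple by (force simp: in_ideal_above_def)

lemma compat_scal: "compat (const2 x) (const2 x) (const2 x)"
  using compat_laurent_triple[OF laurent_triple.mono[of 0 0 0 0 x]] by (simp add: mono1_def mono2_def mono3_def expansion_0)

lemma compat_add:
  assumes "compat s1 s2 s3" "compat t1 t2 t3"
  shows "compat (s1 + t1) (s2 + t2) (s3 + t3)"
proof -
  obtain B where B: "degree_le B s1" "degree_le B s2" "degree_le B s3"
     "\<And>D. \<exists>l1 l2 l3. laurent_triple B l1 l2 l3 \<and> in_ideal_above D (s1 - l1) \<and> in_ideal_above D (s2 - l2) \<and> in_ideal_above D (s3 - l3)"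
    using assms(1) unfolding compat_def by blast
  obtain B' where B': "degree_le B' t1" "degree_le B' t2" "degree_le B' t3"
     "\<And>D. \<exists>l1 l2 l3. laurent_triple B' l1 l2 l3 \<and> in_ideal_above D (t1 - l1) \<and> in_ideal_above D (t2 - l2) \<and> in_ideal_above D (t3 - l3)"
    using assms(2) unfolding compat_def by blast
  let ?M = "max B B'"
  have "\<exists>l1 l2 l3. laurent_triple ?M l1 l2 l3 \<and> in_ideal_above D (s1 + t1 - l1) \<and> in_ideal_above D (s2 + t2 - l2) \<and> in_ideal_above D (s3 + t3 - l3)" for D
  proof -
    obtain l1 l2 l3 where l: "laurent_triple B l1 l2 l3" "in_ideal_above D (s1 - l1)" "in_ideal_above D (s2 - l2)" "in_ideal_above D (s3 - l3)"
      using B(4) by blast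
    obtain l1' l2' l3' where l': "laurent_triple B' l1' l2' l3'" "in_ideal_above D (t1 - l1')" "in_ideal_above D (t2 - l2')" "in_ideal_above D (t3 - l3')"
      using B'(4) by blast
    have "laurent_triple ?M (l1 + l1') (l2 + l2') (l3 + l3')"
      by (intro laurent_triple.add laurent_triple_le[OF l(1)] laurent_triple_le[OF l'(1)]) auto
    moreover have "in_ideal_above D (s + t - (l + l'))" if "in_ideal_above D (s - l)" "in_ideal_above D (t - l')" for s t l l'
      using in_ideal_above_add[OF that] by (simp add: algebra_simps)
    ultimately show ?thesis using l l' by blast
  qed
  moreover have "degree_le ?M (s1 + t1)" "degree_le ?M (s2 + t2)" "degree_le ?M (s3 + t3)"
    using B B' by (auto intro!: degree_le_add elim: degree_le_le)
  ultimately show ?thesis unfolding compat_def by blast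
qed

lemma compat_mult:
  assumes "compat s1 s2 s3" "compat t1 t2 t3"
  shows "compat (s1 * t1) (s2 * t2) (s3 * t3)"
proof -
  obtain B where B: "degree_le B s1" "degree_le B s2" "degree_le B s3"
     "\<And>D. \<exists>l1 l2 l3. laurent_triple B l1 l2 l3 \<and> in_ideal_above D (s1 - l1) \<and> in_ideal_above D (s2 - l2) \<and> in_ideal_above D (s3 - l3)"
    using assms(1) unfolding compat_def by blast
  obtain B' where B': "degree_le B' t1" "degree_le B' t2" "degree_le B' t3"
     "\<And>D. \<exists>l1 l2 l3. laurent_triple B' l1 l2 l3 \<and> in_ideal_above D (t1 - l1) \<and> in_ideal_above D (t2 - l2) \<and> in_ideal_above D (t3 - l3)"
    using assms(2) unfolding compat_def by blast
  let ?M = "B + B'"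
  have "\<exists>l1 l2 l3. laurent_triple ?M l1 l2 l3 \<and> in_ideal_above D (s1 * t1 - l1) \<and> in_ideal_above D (s2 * t2 - l2) \<and> in_ideal_above D (s3 * t3 - l3)" for D
  proof -
    obtain l1 l2 l3 where l: "laurent_triple B l1 l2 l3" "in_ideal_above (D - B') (s1 - l1)" "in_ideal_above (D - B') (s2 - l2)" "in_ideal_above (D - B') (s3 - l3)"
      using B(4) by blast
    obtain l1' l2' l3' where l': "laurent_triple B' l1' l2' l3'" "in_ideal_above (D - B) (t1 - l1')" "in_ideal_above (D - B) (t2 - l2')" "in_ideal_above (D - B) (t3 - l3')"
      using B'(4) by blast
    have "in_ideal_above D (s * t - l * l')" if "in_ideal_above (D - B') (s - l)" "in_ideal_above (D - B) (t - l')" "degree_le B' t" "degree_le B l" for s t l l'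
    proof -
      have "s * t - l * l' = (s - l) * t + l * (t - l')" by (simp add: algebra_simps)
      then show ?thesis
        using in_ideal_above_add[OF in_ideal_above_mult_right[OF that(1,3)]] in_ideal_above_mult_left[OF that(2,4)] by simp
    qed
    then show ?thesis using l l' B' degree_le_laurent_triple[OF l(1)] laurent_triple_mult[OF l(1) l'(1)] by blast
  qed
  moreover have "degree_le ?M (s1 * t1)" "degree_le ?M (s2 * t2)" "degree_le ?M (s3 * t3)"
    using B B' by (auto intro!: degree_le_mult)
  ultimately show ?thesis unfolding compat_def by blast
qed

lemma compat_jacobi:
  assumes "compat s1 s2 s3"
  shows "jac1 i0 i1 i2 s1 - jac2 i0 i1 i2 s2 - jac3 i0 i1 i2 s3 \<in> I"
proof -
  \<comment> \<open>The one total degree in which all three sums read their coefficients.\<close>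
  let ?D = "i0 + i1 + i2 + 1"
  obtain B l1 l2 l3 where l: "laurent_triple B l1 l2 l3" "in_ideal_above ?D (s1 - l1)" "in_ideal_above ?D (s2 - l2)" "in_ideal_above ?D (s3 - l3)"
    using assms unfolding compat_def by meson
  have D: "i1 + i0 + 1 + i2 = ?D" "i2 + i0 + 1 + i1 = ?D" "i2 + i1 + 1 + i0 = ?D" by simp_all
  have n: "jac1 i0 i1 i2 (s1 - l1) \<in> I" "jac2 i0 i1 i2 (s2 - l2) \<in> I" "jac3 i0 i1 i2 (s3 - l3) \<in> I"
    unfolding jac1_def jac2_def jac3_def by (rule res_in_ideal; simp only: D l)+
  have "jac1 i0 i1 i2 s1 - jac2 i0 i1 i2 s2 - jac3 i0 i1 i2 s3 =
    jac1 i0 i1 i2 (s1 - l1) - jac2 i0 i1 i2 (s2 - l2) - jac3 i0 i1 i2 (s3 - l3)"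
    using jac_add(1)[of i0 i1 i2 "s1 - l1" l1] jac_add(2)[of i0 i1 i2 "s2 - l2" l2]
      jac_add(3)[of i0 i1 i2 "s3 - l3" l3] jacobi_laurent_triple[OF l(1), of i0 i1 i2]
    by (simp add: algebra_simps)
  then show ?thesis using n by (simp only: diff)
qed

end

subsection \<open>Expansions of the generators\<close>

lemma expansion_outer: "expansion \<epsilon> k 0 0 $$ i $$ j = (if i = - k \<and> j = 0 then 1 else 0)"
  by (auto simp: expansion_nth_nth gbin_def gbinomial_0_left)

lemma expansion_inner: "expansion \<epsilon> 0 k 0 $$ i $$ j = (if i = 0 \<and> j = - k then 1 else 0)"
  by (auto simp: expansion_nth_nth gbin_def gbinomial_0_left)

lemma sum_delta_neg: "(\<Sum>k\<le>n. if i = - int k \<and> R then f k else 0) =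
    (if i \<le> 0 \<and> - i \<le> int n \<and> R then f (nat (- i)) else (0::'a::comm_monoid_add))"
proof -
  have "(i = - int k \<and> R) = (k = nat (- i) \<and> i \<le> 0 \<and> R)" for k by auto
  then show ?thesis by (cases "i \<le> 0 \<and> R") (auto simp: nat_le_iff)
qed

lemma sum_delta_shift: "(\<Sum>k\<le>n. if i = int k + 2 \<and> R then f k else 0) =
    (if 2 \<le> i \<and> i - 2 \<le> int n \<and> R then f (nat (i - 2)) else (0::'a::comm_monoid_add))"
proof -
  have "(i = int k + 2 \<and> R) = (k = nat (i - 2) \<and> 2 \<le> i \<and> R)" for k by auto
  then show ?thesis by (cases "2 \<le> i \<and> R") (auto simp: nat_le_iff)
qed

text \<open>The coproduct applied first supplies the outer variable. The pairs (outer, inner) are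
  (w1, w2) for \<open>phi1\<close>, (w2, w1) for \<open>phi2\<close> and (w2, w0) for
  \<open>phi3\<close>, as in the three kinds of monomials.\<close>

definition phi1 :: "complex \<Rightarrow> falg fls \<Rightarrow> falg fls fls" where
  "phi1 s3 = fls_map (IdYF s3)"
definition phi2 :: "complex \<Rightarrow> falg fls \<Rightarrow> falg fls fls" where
  "phi2 s3 = fls_map (\<lambda>y. fls_map TF (IdYF s3 y))"
definition phi3 :: "complex \<Rightarrow> falg fls \<Rightarrow> falg fls fls" where
  "phi3 s3 = fls_map (YIdF s3)"

lemma alg_hom_TIdY: "alg_hom fscal (\<lambda>y. fls_map TF (IdYF s3 y))"
  by (rule alg_hom_comp_map[OF alg_homs(2) alg_homs(4)])

lemma ring_hom_phi: "ring_hom (phi1 s3)" "ring_hom (phi2 s3)" "ring_hom (phi3 s3)"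
  unfolding phi1_def phi2_def phi3_def
  by (intro ring_hom.ring_hom_map alg_hom_ring_hom[OF alg_homs(2)] alg_hom_ring_hom[OF alg_homs(3)]
      alg_hom_ring_hom[OF alg_hom_TIdY])+

lemma alg_hom_0: "alg_hom \<kappa> h \<Longrightarrow> h 0 = 0"
  by (rule ring_hom.h_0[OF alg_hom_ring_hom])

lemma fls_map_const:
  assumes "h 0 = 0" shows "fls_map h (fls_const x) = fls_const (h x)"
  by (rule fls_eqI) (simp add: fls_map_nth assms)

lemma hom_zeros: "IdYF s3 0 = 0" "YIdF s3 0 = 0" "TF 0 = 0" "fls_map TF 0 = 0"
  by (rule alg_hom_0, rule alg_homs)+ (rule fls_eqI, simp add: fls_map_nth alg_hom_0[OF alg_homs(4)])

lemma phi_nth: "phi1 s3 f $$ i = IdYF s3 (f $$ i)" "phi2 s3 f $$ i = fls_map TF (IdYF s3 (f $$ i))"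
  "phi3 s3 f $$ i = YIdF s3 (f $$ i)"
  by (simp_all add: phi1_def phi2_def phi3_def fls_map_nth hom_zeros)

lemma phi_scal: "phi1 s3 (fscal c) = const2 (scal c)" "phi2 s3 (fscal c) = const2 (scal c)" "phi3 s3 (fscal c) = const2 (scal c)"
proof -
  have "IdYF s3 (scal c) = fscal c" "YIdF s3 (scal c) = fscal c" "fls_map TF (fscal c) = fscal c"
    using alg_homs(2,3)[of s3] alg_hom_TIdY[of s3] by (simp_all add: alg_hom_def)
  then show "phi1 s3 (fscal c) = const2 (scal c)" "phi2 s3 (fscal c) = const2 (scal c)" "phi3 s3 (fscal c) = const2 (scal c)"
    by (auto intro!: fls_eqI simp: phi_nth hom_zeros)
qed

lemma TF_nth: "fls_map TF f $$ i = TF (f $$ i)"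
  by (simp add: fls_map_nth alg_hom_0[OF alg_homs(4)])

text \<open>The common element is x_2^n + (x_1 + w2)^n + (x_0 + w1)^n, a polynomial, so the
  agreement is exact. In \<open>phi3\<close> the last summand arises as (x_0 + w2 + w0)^n.\<close>

lemma compat_D0F: "laurent_triple (int n) (phi1 s3 (D0F 0 1 n)) (phi2 s3 (D0F 0 1 n)) (phi3 s3 (D0F 0 1 n))"
proof -
  let ?b = "\<lambda>k. scal (of_nat (n choose k))"
  define l where "l = (\<lambda>m :: int \<Rightarrow> int \<Rightarrow> int \<Rightarrow> falg fls fls.
    const2 (gn 2 0 n) * m 0 0 0 + ((\<Sum>k\<le>n. const2 (?b k * gn 1 0 (n - k)) * m 0 (int k) 0)
      + (\<Sum>k\<le>n. const2 (?b k * gn 0 0 (n - k)) * m (int k) 0 0)))"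
  have "laurent_triple (int n) (l mono1) (l mono2) (l mono3)"
    unfolding l_def by (intro laurent_triple.add laurent_triple_sum laurent_triple.mono) auto
  moreover
  interpret h1: ring_hom "IdYF s3" by (rule alg_hom_ring_hom[OF alg_homs(2)])
  interpret h3: ring_hom "YIdF s3" by (rule alg_hom_ring_hom[OF alg_homs(3)])
  interpret t: ring_hom TF by (rule alg_hom_ring_hom[OF alg_homs(4)])
  have c1: "IdYF s3 (scal c) = fscal c" and c3: "YIdF s3 (scal c) = fscal c" and ct: "TF (scal c) = scal c" for c
    using alg_homs by (auto simp: alg_hom_def)
  have p1: "IdYF s3 (D0F 0 1 n $$ i) $$ j = (if i = 0 then D0F 1 2 n $$ j else 0) +
     (if i \<le> 0 \<and> - i \<le> int n \<and> j = 0 then ?b (nat (- i)) * gn 0 0 (n - nat (- i)) else 0)" for i j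
    unfolding D0F_nth[of 0 1] by (auto simp: h1.h_add h1.h_mult c1 gn_images)
  have d: "(\<Sum>k\<le>n. if i = 0 \<and> j = - int k then f k else 0) =
     (\<Sum>k\<le>n. if j = - int k \<and> i = 0 then f k else 0)" for i j and f :: "nat \<Rightarrow> falg"
    by (rule sum.cong) auto
  have mz: "mono1 0 0 0 = 1" "mono2 0 0 0 = 1" "mono3 0 0 0 = 1"
    by (simp_all add: mono1_def mono2_def mono3_def expansion_0)
  have "phi1 s3 (D0F 0 1 n) $$ i $$ j = l mono1 $$ i $$ j" for i j
    unfolding phi_nth p1 l_def mz
    by (simp add: fls_nth_sum mono1_def expansion_outer expansion_inner if_distrib[of "\<lambda>x. _ * x"] d sum_delta_neg
      D0F_nth cong: if_cong)
  moreover have "phi2 s3 (D0F 0 1 n) $$ i $$ j = l mono2 $$ i $$ j" for i j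
    unfolding phi_nth TF_nth p1 l_def mz
    by (simp add: fls_nth_sum mono2_def expansion_outer expansion_inner if_distrib[of "\<lambda>x. _ * x"] d sum_delta_neg
      D0F_nth t.h_add t.h_mult ct gn_images if_distrib[of TF] add_ac cong: if_cong)
  moreover have "phi3 s3 (D0F 0 1 n) $$ i $$ j = l mono3 $$ i $$ j" for i j
  proof -
    have x: "x * (if P then scal y else 0) = (if P then x * scal y else 0)" for x P y by simp
    have "phi3 s3 (D0F 0 1 n) $$ i $$ j = (if i = 0 \<and> j = 0 then gn 2 0 n else 0) +
      (if i \<le> 0 \<and> - i \<le> int n then ?b (nat (- i)) * D0F 0 1 (n - nat (- i)) $$ j else 0)"
      unfolding phi_nth D0F_nth[of 0 1 n] by (auto simp: h3.h_add h3.h_mult c3 gn_images)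
    moreover have "(\<Sum>k\<le>n. (?b k * gn 0 0 (n - k)) * expansion 1 0 0 (int k) $$ i $$ j) =
      (if i \<le> 0 \<and> - i \<le> int n \<and> j \<le> 0 \<and> - j \<le> int (n - nat (- i)) then
         ?b (nat (- i)) * (scal (of_nat ((n - nat (- i)) choose nat (- j))) * gn 0 0 (n - nat (- i) - nat (- j))) else 0)"
    proof -
      have "(?b k * gn 0 0 (n - k)) * expansion 1 0 0 (int k) $$ i $$ j =
         (if i + j = - int k \<and> i \<le> 0 \<and> j \<le> 0 then
           scal (of_nat ((n choose k) * (k choose nat (- j)))) * gn 0 0 (n - k) else 0)" for k
      proof (cases "i + j = - int k \<and> i \<le> 0 \<and> j \<le> 0")
        case True
        then have e: "nat (i + int k) = nat (- j)" "- int k \<le> i" by auto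
        show ?thesis using True e
          by (simp add: expansion_nth_nth gbin_of_nat mult.assoc scal_sandwich)
      next
        case False
        \<comment> \<open>On the support of the expansion, failure of the condition means
          \<open>i > 0\<close>, and there the binomial series with natural exponent \<open>k\<close>
          has already terminated.\<close>
        have "expansion 1 0 0 (int k) $$ i $$ j = 0"
        proof (cases "- int k \<le> i \<and> i + j = - int k")
          case True
          then have "k < nat (i + int k)" using False by auto
          then show ?thesis by (simp add: expansion_nth_nth gbin_of_nat binomial_eq_0)
        qed (auto simp: expansion_nth_nth)
        then show ?thesis by (subst if_not_P[OF False]) simp
      qed
      then have "(\<Sum>k\<le>n. (?b k * gn 0 0 (n - k)) * expansion 1 0 0 (int k) $$ i $$ j) =
        (if i + j \<le> 0 \<and> - (i + j) \<le> int n \<and> i \<le> 0 \<and> j \<le> 0 then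
           scal (of_nat ((n choose nat (- (i + j))) * (nat (- (i + j)) choose nat (- j)))) * gn 0 0 (n - nat (- (i + j))) else 0)"
        by (simp only: sum_delta_neg)
      also have "\<dots> = (if i \<le> 0 \<and> - i \<le> int n \<and> j \<le> 0 \<and> - j \<le> int (n - nat (- i)) then
         ?b (nat (- i)) * (scal (of_nat ((n - nat (- i)) choose nat (- j))) * gn 0 0 (n - nat (- i) - nat (- j))) else 0)"
      proof (cases "i \<le> 0 \<and> j \<le> 0 \<and> - (i + j) \<le> int n")
        case True
        define p q where "p = nat (- i)" and "q = nat (- j)"
        have pq: "i = - int p" "j = - int q" "p + q \<le> n" using True by (auto simp: p_def q_def)
        \<comment> \<open>Both sides are the trinomial coefficient of w2^p w0^q: translating once by
          w2 + w0 agrees with translating twice.\<close>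
        have "(n choose (p + q)) * ((p + q) choose p) = (n choose p) * ((n - p) choose q)"
          using choose_mult[of p "p + q" n] pq by simp
        moreover have "(p + q) choose p = (p + q) choose q"
          using binomial_symmetric[of p "p + q"] by simp
        moreover have "nat (int p + int q) = p + q" by simp
        ultimately have "scal (of_nat ((n choose (p + q)) * ((p + q) choose q))) =
           scal (of_nat (n choose p)) * scal (of_nat ((n - p) choose q))"
          by (simp only: scal_mult[symmetric] of_nat_mult[symmetric])
        then show ?thesis using pq \<open>nat (int p + int q) = p + q\<close>
          by (simp add: mult.assoc[symmetric] add.commute)
      qed auto
      finally show ?thesis .
    qed
    ultimately show ?thesis
      unfolding l_def mz
      by (simp add: fls_nth_sum mono3_def expansion_outer if_distrib[of "\<lambda>x. _ * x"] sum_delta_neg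
         D0F_nth add_ac distrib_left cong: if_cong)
  qed
  ultimately have "phi1 s3 (D0F 0 1 n) = l mono1" "phi2 s3 (D0F 0 1 n) = l mono2" "phi3 s3 (D0F 0 1 n) = l mono3"
    by (auto intro!: fls_eqI)
  then show ?thesis using \<open>laurent_triple (int n) (l mono1) (l mono2) (l mono3)\<close> by simp
qed

text \<open>The coefficient of w^(-K-2) in 2 s3 (w + x_u - x_v)^(-2).\<close>

definition pairing :: "complex \<Rightarrow> nat \<Rightarrow> nat \<Rightarrow> nat \<Rightarrow> falg" where
  "pairing s3 u v K = (\<Sum>n\<le>K. scal (coup s3 n (K - n)) * (gn u 0 n * gn v 0 (K - n)))"

text \<open>The coefficient of X^(-i) Y^(-j) in (X + \<epsilon> Y)^(-i-j), expanded for |X| > |Y|.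
  Only the exponents -K-2 of the interaction occur, whence \<open>2 \<le> i + j\<close>.\<close>

definition mixed_coeff :: "complex \<Rightarrow> int \<Rightarrow> int \<Rightarrow> falg" where
  "mixed_coeff \<epsilon> i j = (if j \<le> 0 \<and> 2 \<le> i + j then scal (gbin (- (i + j)) (nat (- j)) * \<epsilon> ^ nat (- j)) else 0)"

lemma D20F_pairing: "D20F s3 a b $$ i = (if i = 0 then gn b 2 0 + gn a 2 0 else 0) +
     (if 2 \<le> i then pairing s3 a b (nat (i - 2)) else 0)"
  by (simp add: D20F_nth pairing_def)

lemma gbin_neg_choose: "gbin (- int (p + 2)) q * (-1) ^ q = of_nat ((p + q + 1) choose q)"
proof -
  have "int q - - int (p + 2) - 1 = int (p + q + 1)" by simp
  then have "gbin (- int (p + 2)) q = (-1)^q * of_nat ((p + q + 1) choose q)"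
    by (simp only: gbin_negated[of "- int (p + 2)" q] gbin_of_nat)
  then show ?thesis by simp
qed

text \<open>Coefficientwise, this says that (X + x - (y + Y))^(-2) can be expanded either in x and y
  + Y over X, or in x and y over X - Y. \<open>coup_left\<close> does the same for x + Y and X +
  Y.\<close>

lemma coup_right:
  "coup s3 n (l + q) * of_nat ((l + q) choose q) = coup s3 n l * (gbin (- int (n + l + 2)) q * (-1) ^ q)"
  unfolding gbin_neg_choose coup_def by (simp add: binomial_fact field_simps del: fact_Suc)

lemma coup_left:
  "coup s3 (n + q) l * of_nat ((n + q) choose q) = coup s3 n l * gbin (- int (n + l + 2)) q"
proof -
  have "coup s3 (n + q) l * of_nat ((n + q) choose q) = (-1)^q * (coup s3 n l * of_nat ((n + l + q + 1) choose q))"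
    unfolding coup_def by (simp add: binomial_fact field_simps power_add del: fact_Suc)
  also have "\<dots> = coup s3 n l * gbin (- int (n + l + 2)) q"
    unfolding gbin_neg_choose[symmetric] by (simp add: mult_ac)
  finally show ?thesis .
qed

text \<open>Applying the coproduct in the second slot of the interaction leaves one copy
  \<open>b\<close> in place, which contributes only for \<open>j = 0\<close>, and translates the
  copy \<open>a\<close>, which replaces X by X - Y.\<close>

lemma conv_right:
  "(\<Sum>n\<le>K. scal (coup s3 n (K - n)) * (gn u 0 n * D0F a b (K - n) $$ j)) =
   (if j = 0 then pairing s3 u b K else 0) + mixed_coeff (-1) (int K + 2) j * pairing s3 u a (nat (int K + j))"
proof (cases "j \<le> 0")
  case True
  define q where "q = nat (- j)"
  have j: "j = - int q" using True by (simp add: q_def)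
  have D: "D0F a b m $$ j = (if q = 0 then gn b 0 m else 0) +
     (if q \<le> m then scal (of_nat (m choose q)) * gn a 0 (m - q) else 0)" for m
    by (auto simp: D0F_nth j)
  have "(\<Sum>n\<le>K. scal (coup s3 n (K - n)) * (gn u 0 n *
          (if q \<le> K - n then scal (of_nat ((K - n) choose q)) * gn a 0 (K - n - q) else 0)))
     = mixed_coeff (-1) (int K + 2) j * pairing s3 u a (nat (int K + j))"
  proof (cases "q \<le> K")
    case qK: True
    have "(\<Sum>n\<le>K. scal (coup s3 n (K - n)) * (gn u 0 n *
          (if q \<le> K - n then scal (of_nat ((K - n) choose q)) * gn a 0 (K - n - q) else 0)))
      = (\<Sum>n\<le>K - q. scal (coup s3 n (K - n)) * (gn u 0 n *
          (scal (of_nat ((K - n) choose q)) * gn a 0 (K - n - q))))"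
      by (rule sum.mono_neutral_cong_right) (use qK in auto)
    also have "\<dots> = (\<Sum>n\<le>K - q. mixed_coeff (-1) (int K + 2) j *
        (scal (coup s3 n (K - q - n)) * (gn u 0 n * gn a 0 (K - q - n))))"
    proof (rule sum.cong)
      fix n assume "n \<in> {..K - q}"
      then obtain l where l: "K = n + l + q" using qK by (auto simp: le_iff_add)
      have G: "mixed_coeff (-1) (int K + 2) j = scal (gbin (- int (n + l + 2)) q * (-1) ^ q)"
      proof -
        have "- (int K + 2 + j) = - int (n + l + 2)" by (simp add: j l)
        then show ?thesis by (simp only: mixed_coeff_def) (simp add: j l)
      qed
      have "scal (coup s3 n (K - n)) * (gn u 0 n * (scal (of_nat ((K - n) choose q)) * gn a 0 (K - n - q)))
         = scal (coup s3 n (l + q) * of_nat ((l + q) choose q)) * (gn u 0 n * gn a 0 l)"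
        by (simp add: l scal_left_comm[of "gn u 0 n"] scal_mult mult.assoc)
      also have "\<dots> = mixed_coeff (-1) (int K + 2) j * (scal (coup s3 n l) * (gn u 0 n * gn a 0 l))"
        unfolding coup_right G by (simp only: mult.commute[of "coup s3 n l"] scal_mult mult.assoc)
      finally show "scal (coup s3 n (K - n)) * (gn u 0 n * (scal (of_nat ((K - n) choose q)) * gn a 0 (K - n - q)))
         = mixed_coeff (-1) (int K + 2) j * (scal (coup s3 n (K - q - n)) * (gn u 0 n * gn a 0 (K - q - n)))"
        by (simp add: l)
    qed simp
    also have "nat (int K + j) = K - q" using qK by (simp add: j)
    ultimately show ?thesis
      by (simp add: pairing_def sum_distrib_left)
  next
    case False
    then show ?thesis by (auto simp: mixed_coeff_def j intro!: sum.neutral)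
  qed
  then show ?thesis
    unfolding D by (cases "q = 0") (simp_all add: j distrib_left sum.distrib pairing_def)
qed (simp add: D0F_nth mixed_coeff_def)

lemma conv_left:
  "(\<Sum>n\<le>K. scal (coup s3 n (K - n)) * (D0F a b n $$ j * gn u 0 (K - n))) =
   (if j = 0 then pairing s3 b u K else 0) + mixed_coeff 1 (int K + 2) j * pairing s3 a u (nat (int K + j))"
proof (cases "j \<le> 0")
  case True
  define q where "q = nat (- j)"
  have j: "j = - int q" using True by (simp add: q_def)
  have D: "D0F a b m $$ j = (if q = 0 then gn b 0 m else 0) +
     (if q \<le> m then scal (of_nat (m choose q)) * gn a 0 (m - q) else 0)" for m
    by (auto simp: D0F_nth j)
  have "(\<Sum>n\<le>K. scal (coup s3 n (K - n)) * ((if q \<le> n then scal (of_nat (n choose q)) * gn a 0 (n - q) else 0)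
          * gn u 0 (K - n)))
     = mixed_coeff 1 (int K + 2) j * pairing s3 a u (nat (int K + j))"
  proof (cases "q \<le> K")
    case qK: True
    have "(\<Sum>n\<le>K. scal (coup s3 n (K - n)) * ((if q \<le> n then scal (of_nat (n choose q)) * gn a 0 (n - q) else 0)
          * gn u 0 (K - n)))
      = (\<Sum>n\<in>{q..K}. scal (coup s3 n (K - n)) * (scal (of_nat (n choose q)) * gn a 0 (n - q) * gn u 0 (K - n)))"
      by (rule sum.mono_neutral_cong_right) auto
    also have "\<dots> = (\<Sum>n\<le>K - q. scal (coup s3 (n + q) (K - (n + q))) *
        (scal (of_nat ((n + q) choose q)) * gn a 0 n * gn u 0 (K - (n + q))))"
      by (rule sum.reindex_bij_witness[of _ "\<lambda>n. n + q" "\<lambda>n. n - q"]) (use qK in auto)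
    also have "\<dots> = (\<Sum>n\<le>K - q. mixed_coeff 1 (int K + 2) j *
        (scal (coup s3 n (K - q - n)) * (gn a 0 n * gn u 0 (K - q - n))))"
    proof (rule sum.cong)
      fix n assume "n \<in> {..K - q}"
      then obtain l where l: "K = n + l + q" using qK by (auto simp: le_iff_add)
      have G: "mixed_coeff 1 (int K + 2) j = scal (gbin (- int (n + l + 2)) q)"
      proof -
        have "- (int K + 2 + j) = - int (n + l + 2)" by (simp add: j l)
        then show ?thesis by (simp only: mixed_coeff_def) (simp add: j l)
      qed
      have "scal (coup s3 (n + q) (K - (n + q))) * (scal (of_nat ((n + q) choose q)) * gn a 0 n * gn u 0 (K - (n + q)))
         = scal (coup s3 (n + q) l * of_nat ((n + q) choose q)) * (gn a 0 n * gn u 0 l)"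
        by (simp add: l scal_mult mult.assoc)
      also have "\<dots> = mixed_coeff 1 (int K + 2) j * (scal (coup s3 n l) * (gn a 0 n * gn u 0 l))"
        unfolding coup_left G by (simp only: mult.commute[of "coup s3 n l"] scal_mult mult.assoc)
      finally show "scal (coup s3 (n + q) (K - (n + q))) * (scal (of_nat ((n + q) choose q)) * gn a 0 n * gn u 0 (K - (n + q)))
         = mixed_coeff 1 (int K + 2) j * (scal (coup s3 n (K - q - n)) * (gn a 0 n * gn u 0 (K - q - n)))"
        by (simp add: l)
    qed simp
    also have "nat (int K + j) = K - q" using qK by (simp add: j)
    ultimately show ?thesis
      by (simp add: pairing_def sum_distrib_left)
  next
    case False
    then show ?thesis by (auto simp: mixed_coeff_def j intro!: sum.neutral)
  qed
  then show ?thesis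
    unfolding D by (cases "q = 0") (simp_all add: j distrib_left distrib_right sum.distrib pairing_def)
qed (simp add: D0F_nth mixed_coeff_def)

text \<open>The last three summands are the interactions of the pairs (1,2), (0,2) and (0,1), with
  parameters w2, w1 and w1 - w2.\<close>

lemma IdYF_t20:
  "IdYF s3 (D20F s3 0 1 $$ i) $$ j = (if i = 0 \<and> j = 0 then gn 0 2 0 + gn 1 2 0 + gn 2 2 0 else 0)
    + (if i = 0 \<and> 2 \<le> j then pairing s3 1 2 (nat (j - 2)) else 0)
    + (if j = 0 \<and> 2 \<le> i then pairing s3 0 2 (nat (i - 2)) else 0)
    + mixed_coeff (-1) i j * pairing s3 0 1 (nat (i + j - 2))"
proof -
  interpret h: ring_hom "IdYF s3" by (rule alg_hom_ring_hom[OF alg_homs(2)])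
  have c: "IdYF s3 (scal c) = fscal c" for c using alg_homs by (auto simp: alg_hom_def)
  have DlF20: "DlF s3 a b 2 0 = D20F s3 a b" for a b by (simp add: numeral_2_eq_2)
  have A: "IdYF s3 (pairing s3 0 1 K) $$ j = (if j = 0 then pairing s3 0 2 K else 0) +
      mixed_coeff (-1) (int K + 2) j * pairing s3 0 1 (nat (int K + j))" for K
    unfolding conv_right[symmetric]
    by (simp add: pairing_def h.h_sum h.h_mult c gn_images fls_nth_sum)
  consider "i = 0" | "2 \<le> i" | "i \<noteq> 0" "i < 2" by linarith
  then show ?thesis
  proof cases
    case 1
    have "mixed_coeff (-1) 0 j = 0" by (simp add: mixed_coeff_def)
    then show ?thesis
      using 1 by (simp add: D20F_pairing[of s3 0] h.h_add gn_images DlF20) (simp add: D20F_pairing add_ac)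
  next
    case 2
    then have "int (nat (i - 2)) + 2 = i" "nat (int (nat (i - 2)) + j) = nat (i + j - 2)"
      by (simp_all add: algebra_simps)
    then show ?thesis using 2 A[of "nat (i - 2)"] by (simp add: D20F_pairing)
  next
    case 3
    then have "mixed_coeff (-1) i j = 0" by (simp add: mixed_coeff_def)
    then show ?thesis using 3 by (simp add: D20F_pairing)
  qed
qed

lemma YIdF_t20:
  "YIdF s3 (D20F s3 0 1 $$ i) $$ j = (if i = 0 \<and> j = 0 then gn 0 2 0 + gn 1 2 0 + gn 2 2 0 else 0)
    + (if i = 0 \<and> 2 \<le> j then pairing s3 0 1 (nat (j - 2)) else 0)
    + (if j = 0 \<and> 2 \<le> i then pairing s3 1 2 (nat (i - 2)) else 0)
    + mixed_coeff 1 i j * pairing s3 0 2 (nat (i + j - 2))"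
proof -
  interpret h: ring_hom "YIdF s3" by (rule alg_hom_ring_hom[OF alg_homs(3)])
  have c: "YIdF s3 (scal c) = fscal c" for c using alg_homs by (auto simp: alg_hom_def)
  have DlF20: "DlF s3 a b 2 0 = D20F s3 a b" for a b by (simp add: numeral_2_eq_2)
  have A: "YIdF s3 (pairing s3 0 1 K) $$ j = (if j = 0 then pairing s3 1 2 K else 0) +
      mixed_coeff 1 (int K + 2) j * pairing s3 0 2 (nat (int K + j))" for K
    unfolding conv_left[symmetric]
    by (simp add: pairing_def h.h_sum h.h_mult c gn_images fls_nth_sum)
  consider "i = 0" | "2 \<le> i" | "i \<noteq> 0" "i < 2" by linarith
  then show ?thesis
  proof cases
    case 1
    have "mixed_coeff 1 0 j = 0" by (simp add: mixed_coeff_def)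
    then show ?thesis
      using 1 by (simp add: D20F_pairing[of s3 0] h.h_add gn_images DlF20)
  next
    case 2
    then have "int (nat (i - 2)) + 2 = i" "nat (int (nat (i - 2)) + j) = nat (i + j - 2)"
      by (simp_all add: algebra_simps)
    then show ?thesis using 2 A[of "nat (i - 2)"] by (simp add: D20F_pairing)
  next
    case 3
    then have "mixed_coeff 1 i j = 0" by (simp add: mixed_coeff_def)
    then show ?thesis using 3 by (simp add: D20F_pairing)
  qed
qed

lemma TF_pairing: "TF (pairing s3 0 1 K) = pairing s3 1 0 K" "TF (pairing s3 0 2 K) = pairing s3 1 2 K" "TF (pairing s3 1 2 K) = pairing s3 0 2 K"
proof -
  interpret t: ring_hom TF by (rule alg_hom_ring_hom[OF alg_homs(4)])
  have ct: "TF (scal c) = scal c" for c using alg_homs(4) by (auto simp: alg_hom_def)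
  show "TF (pairing s3 0 1 K) = pairing s3 1 0 K" "TF (pairing s3 0 2 K) = pairing s3 1 2 K" "TF (pairing s3 1 2 K) = pairing s3 0 2 K"
    by (simp_all add: pairing_def t.h_sum t.h_mult ct gn_images)
qed

lemma TF_IdYF_t20:
  "TF (IdYF s3 (D20F s3 0 1 $$ i) $$ j) = (if i = 0 \<and> j = 0 then gn 0 2 0 + gn 1 2 0 + gn 2 2 0 else 0)
    + (if i = 0 \<and> 2 \<le> j then pairing s3 0 2 (nat (j - 2)) else 0)
    + (if j = 0 \<and> 2 \<le> i then pairing s3 1 2 (nat (i - 2)) else 0)
    + mixed_coeff (-1) i j * pairing s3 1 0 (nat (i + j - 2))"
proof -
  interpret t: ring_hom TF by (rule alg_hom_ring_hom[OF alg_homs(4)])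
  have ct: "TF (scal c) = scal c" for c using alg_homs(4) by (auto simp: alg_hom_def)
  have "TF (mixed_coeff (-1) i j) = mixed_coeff (-1) i j" by (simp add: mixed_coeff_def ct)
  moreover have "TF (gn 0 2 0 + gn 1 2 0 + gn 2 2 0) = gn 0 2 0 + gn 1 2 0 + gn 2 2 0"
    by (simp add: t.h_add gn_images add_ac)
  moreover have "TF (if P then x else 0) = (if P then TF x else 0)" for P x by simp
  ultimately show ?thesis
    unfolding IdYF_t20 by (simp only: t.h_add t.h_mult TF_pairing)
qed

text \<open>The square (w + x_0 - x_1)^2 is unchanged when its base is negated, which produces the
  sign (-1)^K. The remaining difference is the order of letters from two different factors, where
  commutation is used.\<close>

lemma pairing_swap: "pairing s3 1 0 K - scal ((-1) ^ K) * pairing s3 0 1 K \<in> idF s2 s3 3"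
proof -
  interpret ideal2 "idF s2 s3 3" by (rule ideal2_idF)
  have c: "coup s3 (K - n) n = (-1) ^ K * coup s3 n (K - n)" if "n \<le> K" for n
  proof -
    have "(-1::complex) ^ (K - n) = (-1) ^ K * (-1) ^ n"
      using that by (auto simp: minus_one_power_iff)
    then show ?thesis using that by (simp add: coup_def add.commute mult.commute)
  qed
  have "pairing s3 1 0 K = (\<Sum>n\<le>K. scal (coup s3 (K - n) n) * (gn 1 0 (K - n) * gn 0 0 n))"
    unfolding pairing_def by (rule sum.reindex_bij_witness[of _ "\<lambda>n. K - n" "\<lambda>n. K - n"]) auto
  also have "\<dots> = (\<Sum>n\<le>K. scal ((-1) ^ K) * (scal (coup s3 n (K - n)) * (gn 1 0 (K - n) * gn 0 0 n)))"
    by (rule sum.cong) (auto simp: c scal_mult mult.assoc)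
  finally have "pairing s3 1 0 K - scal ((-1) ^ K) * pairing s3 0 1 K =
     (\<Sum>n\<le>K. scal ((-1) ^ K) * (scal (coup s3 n (K - n)) * (gn 1 0 (K - n) * gn 0 0 n - gn 0 0 n * gn 1 0 (K - n))))"
    by (simp add: pairing_def sum_distrib_left right_diff_distrib sum_subtractf)
  also have "\<dots> \<in> idF s2 s3 3"
    by (intro sum mult_left idF_comm) auto
  finally show ?thesis .
qed

section \<open>Truncations of the image of t_{2,0}\<close>

lemma expansion_diag: "expansion \<epsilon> 0 0 (- int k - 2) $$ i $$ j = (if i + j = int k + 2 then mixed_coeff \<epsilon> i j else 0)"
proof (cases "i + j = int k + 2")
  case True
  then have "nat (i + 0 + (- int k - 2)) = nat (- j)" "- (i + j) = - int k - 2" by auto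
  then show ?thesis using True by (auto simp: expansion_nth_nth mixed_coeff_def)
qed (auto simp: expansion_nth_nth)

lemma sum_outer: "(\<Sum>k\<le>N. const2 (x k) * expansion \<epsilon> (- int k - 2) 0 0) $$ i $$ j =
    (if 2 \<le> i \<and> i - 2 \<le> int N \<and> j = 0 then x (nat (i - 2)) else 0)"
proof -
  have "(\<Sum>k\<le>N. const2 (x k) * expansion \<epsilon> (- int k - 2) 0 0) $$ i $$ j =
      (\<Sum>k\<le>N. if i = int k + 2 \<and> j = 0 then x k else 0)"
    by (simp add: fls_nth_sum, rule sum.cong) (auto simp: expansion_outer)
  then show ?thesis by (simp only: sum_delta_shift)
qed

lemma sum_inner: "(\<Sum>k\<le>N. const2 (x k) * expansion \<epsilon> 0 (- int k - 2) 0) $$ i $$ j =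
    (if 2 \<le> j \<and> j - 2 \<le> int N \<and> i = 0 then x (nat (j - 2)) else 0)"
proof -
  have "(\<Sum>k\<le>N. const2 (x k) * expansion \<epsilon> 0 (- int k - 2) 0) $$ i $$ j =
      (\<Sum>k\<le>N. if j = int k + 2 \<and> i = 0 then x k else 0)"
    by (simp add: fls_nth_sum, rule sum.cong) (auto simp: expansion_inner)
  then show ?thesis by (simp only: sum_delta_shift)
qed

lemma mixed_coeff_comm: "x * mixed_coeff \<epsilon> i j = mixed_coeff \<epsilon> i j * x"
  by (simp add: mixed_coeff_def scal_comm)

lemma sum_diag:
  assumes "i + j - 2 \<le> int N"
  shows "(\<Sum>k\<le>N. const2 (x k) * expansion \<epsilon> 0 0 (- int k - 2)) $$ i $$ j = mixed_coeff \<epsilon> i j * x (nat (i + j - 2))"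
proof -
  have "(\<Sum>k\<le>N. const2 (x k) * expansion \<epsilon> 0 0 (- int k - 2)) $$ i $$ j =
      (\<Sum>k\<le>N. if i + j = int k + 2 \<and> True then mixed_coeff \<epsilon> i j * x k else 0)"
    by (simp add: fls_nth_sum, rule sum.cong) (auto simp: expansion_diag mixed_coeff_comm)
  also have "\<dots> = (if 2 \<le> i + j \<and> i + j - 2 \<le> int N \<and> True then mixed_coeff \<epsilon> i j * x (nat (i + j - 2)) else 0)"
    by (rule sum_delta_shift)
  also have "\<dots> = mixed_coeff \<epsilon> i j * x (nat (i + j - 2))"
    using assms by (auto simp: mixed_coeff_def)
  finally show ?thesis .
qed

lemma degree_le_phi_D20F:
  "degree_le 0 (phi1 s3 (D20F s3 0 1))" "degree_le 0 (phi2 s3 (D20F s3 0 1))" "degree_le 0 (phi3 s3 (D20F s3 0 1))"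
  unfolding degree_le_def phi_nth TF_nth IdYF_t20 TF_IdYF_t20 YIdF_t20 by (auto simp: mixed_coeff_def hom_zeros)

lemma ideal_falg_idF: "ideal_falg (idF s2 s3 3)"
  by (intro ideal_falg.intro ideal2_idF)

lemma compat_D20F:
  "ideal_falg.compat (idF s2 s3 3) (phi1 s3 (D20F s3 0 1)) (phi2 s3 (D20F s3 0 1)) (phi3 s3 (D20F s3 0 1))"
proof -
  interpret ideal_falg "idF s2 s3 3" by (rule ideal_falg_idF)
  have "\<exists>l1 l2 l3. laurent_triple 0 l1 l2 l3 \<and> in_ideal_above D (phi1 s3 (D20F s3 0 1) - l1) \<and>
      in_ideal_above D (phi2 s3 (D20F s3 0 1) - l2) \<and> in_ideal_above D (phi3 s3 (D20F s3 0 1) - l3)" for D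
  proof -
    \<comment> \<open>The omitted terms, with \<open>k > N\<close>, have total degree -k-2 <
      D.\<close>
    define N where "N = nat (- D)"
    define t where "t = gn 0 2 0 + gn 1 2 0 + gn 2 2 0"
    define l where "l = (\<lambda>m :: int \<Rightarrow> int \<Rightarrow> int \<Rightarrow> falg fls fls.
      const2 t * m 0 0 0 + ((\<Sum>k\<le>N. const2 (pairing s3 0 2 k) * m (- int k - 2) 0 0)
       + ((\<Sum>k\<le>N. const2 (pairing s3 1 2 k) * m 0 (- int k - 2) 0)
       + (\<Sum>k\<le>N. const2 (pairing s3 0 1 k) * m 0 0 (- int k - 2)))))"
    have laurent_triple: "laurent_triple 0 (l mono1) (l mono2) (l mono3)"
      unfolding l_def by (intro laurent_triple.add laurent_triple_sum laurent_triple.mono) auto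
    have mz: "mono1 0 0 0 = 1" "mono2 0 0 0 = 1" "mono3 0 0 0 = 1"
      by (simp_all add: mono1_def mono2_def mono3_def expansion_0)
    have sg: "(-1::complex) powi (- int k - 2) = (-1) ^ k" for k
    proof -
      have "(-1::complex) powi (- int (k + 2)) = (-1) ^ k"
        by (simp only: power_int_minus power_int_of_nat) (simp add: minus_one_power_iff)
      moreover have "- int (k + 2) = - int k - 2" by simp
      ultimately show ?thesis by metis
    qed
    have m2d: "const2 x * mono2 0 0 (- int k - 2) = const2 (scal ((-1) ^ k) * x) * expansion (-1) 0 0 (- int k - 2)" for x k
      by (simp only: mono2_def sg mult.assoc[symmetric] const2_mult scal_comm)
    have m2o: "mono2 0 c 0 = expansion (-1) c 0 0" "mono2 c 0 0 = expansion (-1) 0 c 0" for c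
      by (simp_all add: mono2_def)
    have t0: "(const2 t * 1) $$ i $$ j = (if i = 0 \<and> j = 0 then t else 0)" for i j
      by simp
    have eq: "(2 \<le> i \<and> i - 2 \<le> int N \<and> j = 0) = (j = 0 \<and> 2 \<le> i)"
      "(2 \<le> j \<and> j - 2 \<le> int N \<and> i = 0) = (i = 0 \<and> 2 \<le> j)"
      if "i + j - 2 \<le> int N" for i j
      using that by auto
    have "phi1 s3 (D20F s3 0 1) $$ i $$ j - l mono1 $$ i $$ j = 0" if "- (i + j) \<ge> D" for i j
    proof -
      have ij: "i + j - 2 \<le> int N" using that by (simp add: N_def)
      show ?thesis
        unfolding l_def mz expansion_0 fls_plus_nth mono1_def sum_outer sum_inner sum_diag[OF ij] phi_nth IdYF_t20 t0
          t_def[symmetric] eq[OF ij] by (simp only: add_ac diff_self)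
    qed
    then have 1: "in_ideal_above D (phi1 s3 (D20F s3 0 1) - l mono1)" by (simp add: in_ideal_above_def)
    have p2: "phi2 s3 (D20F s3 0 1) $$ i $$ j - l mono2 $$ i $$ j =
        mixed_coeff (-1) i j * (pairing s3 1 0 (nat (i + j - 2)) - scal ((-1) ^ nat (i + j - 2)) * pairing s3 0 1 (nat (i + j - 2)))"
      if "- (i + j) \<ge> D" for i j
    proof -
      have ij: "i + j - 2 \<le> int N" using that by (simp add: N_def)
      show ?thesis
        unfolding l_def mz expansion_0 fls_plus_nth m2o m2d sum_outer sum_inner sum_diag[OF ij] phi_nth TF_nth TF_IdYF_t20 t0
          t_def[symmetric] eq[OF ij] by (simp only: add.assoc right_diff_distrib add_diff_cancel_left)
    qed
    have 2: "in_ideal_above D (phi2 s3 (D20F s3 0 1) - l mono2)"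
      unfolding in_ideal_above_def fls_minus_nth
    proof (intro allI impI)
      fix i j assume d: "- (i + j) \<ge> D"
      show "phi2 s3 (D20F s3 0 1) $$ i $$ j - l mono2 $$ i $$ j \<in> idF s2 s3 3"
        unfolding p2[OF d] by (intro mult_left pairing_swap)
    qed
    have "phi3 s3 (D20F s3 0 1) $$ i $$ j - l mono3 $$ i $$ j = 0" if "- (i + j) \<ge> D" for i j
    proof -
      have ij: "i + j - 2 \<le> int N" using that by (simp add: N_def)
      show ?thesis
        unfolding l_def mz expansion_0 fls_plus_nth mono3_def sum_outer sum_inner sum_diag[OF ij] phi_nth YIdF_t20 t0
          t_def[symmetric] eq[OF ij] by (simp only: add_ac diff_self)
    qed
    then have 3: "in_ideal_above D (phi3 s3 (D20F s3 0 1) - l mono3)" by (simp add: in_ideal_above_def)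
    show ?thesis using laurent_triple 1 2 3 by blast
  qed
  then show ?thesis unfolding compat_def using degree_le_phi_D20F by blast
qed

section \<open>From the generators to all elements\<close>

lemma compat_DlF:
  "ideal_falg.compat (idF s2 s3 3) (phi1 s3 (DlF s3 0 1 m n)) (phi2 s3 (DlF s3 0 1 m n)) (phi3 s3 (DlF s3 0 1 m n))"
proof -
  interpret ideal_falg "idF s2 s3 3" by (rule ideal_falg_idF)
  interpret h1: ring_hom "phi1 s3" by (rule ring_hom_phi)
  interpret h2: ring_hom "phi2 s3" by (rule ring_hom_phi)
  interpret h3: ring_hom "phi3 s3" by (rule ring_hom_phi)
  have diff: "compat (s1 - t1) (s2' - t2) (s3' - t3)" if "compat s1 s2' s3'" "compat t1 t2 t3" for s1 s2' s3' t1 t2 t3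
    using compat_add[OF that(1) compat_mult[OF compat_scal[of "- 1"] that(2)]]
    by (simp add: fls_const_uminus)
  show ?thesis
  proof (induction m arbitrary: n)
    case 0 show ?case using compat_laurent_triple[OF compat_D0F] by simp
  next
    case (Suc m)
    show ?case
    proof (cases "Suc m = 2 \<and> n = 0")
      case True
      have "DlF s3 0 1 (Suc m) n = D20F s3 0 1"
        by (subst DlF.simps(2), subst if_P[OF True]) (rule refl)
      then show ?thesis using compat_D20F by simp
    next
      case False
      then have e: "DlF s3 0 1 (Suc m) n = fscal (1 / (2 * of_nat (n+1))) *
         (D20F s3 0 1 * DlF s3 0 1 m (n+1) - DlF s3 0 1 m (n+1) * D20F s3 0 1)"
        by (simp only: DlF.simps if_False)
      show ?thesis unfolding e h1.h_mult h2.h_mult h3.h_mult h1.h_diff h2.h_diff h3.h_diff phi_scal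
        by (intro compat_mult compat_scal diff Suc compat_D20F)
    qed
  qed
qed

lemma compat_YF:
  "ideal_falg.compat (idF s2 s3 3) (phi1 s3 (YF s3 x)) (phi2 s3 (YF s3 x)) (phi3 s3 (YF s3 x))"
proof -
  interpret ideal_falg "idF s2 s3 3" by (rule ideal_falg_idF)
  interpret h1: ring_hom "phi1 s3" by (rule ring_hom_phi)
  interpret h2: ring_hom "phi2 s3" by (rule ring_hom_phi)
  interpret h3: ring_hom "phi3 s3" by (rule ring_hom_phi)
  interpret y: ring_hom "YF s3" by (rule alg_hom_ring_hom[OF alg_homs(1)])
  show ?thesis
  proof (induction x rule: falg_induct)
    case (scal c)
    have "YF s3 (scal c) = fscal c" using alg_homs(1) by (auto simp: alg_hom_def)
    then show ?case by (simp add: phi_scal compat_scal)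
  next
    case (gn j m n) show ?case unfolding gn_images by (rule compat_DlF)
  next
    case (add x y) then show ?case unfolding y.h_add h1.h_add h2.h_add h3.h_add by (rule compat_add)
  next
    case (mult x y) then show ?case unfolding y.h_mult h1.h_mult h2.h_mult h3.h_mult by (rule compat_mult)
  qed
qed

subsection \<open>Counit and cocreation\<close>

text \<open>Both unit axioms follow by this induction; \<open>R f x\<close> abstracts the sense in
  which the series \<open>f\<close> represents \<open>x\<close>. \<open>R_cong\<close> lets the
  relations enter, since the commutator that defines the value at t_{m+1,n} represents this
  generator only modulo the ideal.\<close>

lemma DlF_counit:
  fixes R :: "falg fls \<Rightarrow> falg \<Rightarrow> bool"
  assumes h: "alg_hom scal h"
    and R_add: "\<And>f g x y. R f x \<Longrightarrow> R g y \<Longrightarrow> R (f + g) (x + y)"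
    and R_mult: "\<And>f g x y. R f x \<Longrightarrow> R g y \<Longrightarrow> R (f * g) (x * y)"
    and R_scal: "\<And>c. R (fscal c) (scal c)"
    and R_cong: "\<And>f x y. R f x \<Longrightarrow> x - y \<in> idF s2 s3 1 \<Longrightarrow> R f y"
    and D0: "\<And>n. R (fls_map h (D0F 0 1 n)) (gn 0 0 n)"
    and D20: "R (fls_map h (D20F s3 0 1)) (gn 0 2 0)"
    and letters: "\<And>u l. lookup x u \<noteq> 0 \<Longrightarrow> l \<in> set u \<Longrightarrow> fst l = 0"
  shows "R (fls_map h (YF s3 x)) x"
proof -
  interpret ideal2 "idF s2 s3 1" by (rule ideal2_idF)
  interpret h: ring_hom h by (rule alg_hom_ring_hom[OF h])
  interpret H: ring_hom "fls_map h" by (rule h.ring_hom_map)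
  interpret y: ring_hom "YF s3" by (rule alg_hom_ring_hom[OF alg_homs(1)])
  have c: "fls_map h (fscal c) = fscal c" for c
    using h by (simp add: fls_map_const alg_hom_def)
  have R_diff: "R (f - g) (x - y)" if "R f x" "R g y" for f g x y
    using R_add[OF that(1) R_mult[OF R_scal[of "- 1"] that(2)]] by (simp add: scal_uminus)
  have gen: "R (fls_map h (DlF s3 0 1 m n)) (gn 0 m n)" for m n
  proof (induction m arbitrary: n)
    case 0 show ?case using D0 by simp
  next
    case (Suc m)
    show ?case
    proof (cases "Suc m = 2 \<and> n = 0")
      case True
      have "DlF s3 0 1 (Suc m) n = D20F s3 0 1"
        by (subst DlF.simps(2), subst if_P[OF True]) (rule refl)
      then show ?thesis using True D20 by (simp only:)
    next
      case False
      let ?c = "1 / (2 * of_nat (n+1)) :: complex"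
      have e: "DlF s3 0 1 (Suc m) n = fscal ?c *
         (D20F s3 0 1 * DlF s3 0 1 m (n+1) - DlF s3 0 1 m (n+1) * D20F s3 0 1)"
        using False by (simp only: DlF.simps if_False)
      have "R (fls_map h (DlF s3 0 1 (Suc m) n))
         (scal ?c * (gn 0 2 0 * gn 0 m (n+1) - gn 0 m (n+1) * gn 0 2 0))"
        unfolding e H.h_mult H.h_diff c by (intro R_mult R_scal R_diff D20 Suc)
      \<comment> \<open>In the quotient [t_{2,0}, t_{m,n+1}] = 2 (n+1) t_{m+1,n}, and
        \<open>?c\<close> inverts this factor.\<close>
      moreover have "scal ?c * (gn 0 2 0 * gn 0 m (n+1) - gn 0 m (n+1) * gn 0 2 0) - gn 0 (Suc m) n \<in> idF s2 s3 1"
      proof -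
        have "?c * (2 * of_nat (n+1)) = 1" by (simp del: of_nat_Suc)
        then have "scal ?c * (scal (2 * of_nat (n+1)) * x) = x" for x
          by (simp only: mult.assoc[symmetric] scal_mult[symmetric] scal_1 mult_1_left)
        then have "scal ?c * (gn 0 2 0 * gn 0 m (n+1) - gn 0 m (n+1) * gn 0 2 0 - scal (2 * of_nat (n+1)) * gn 0 (m+1) (n+1-1))
            = scal ?c * (gn 0 2 0 * gn 0 m (n+1) - gn 0 m (n+1) * gn 0 2 0) - gn 0 (Suc m) n"
          unfolding right_diff_distrib[of "scal ?c" _ "scal (2 * of_nat (n+1)) * gn 0 (m+1) (n+1-1)"] by simp
        then show ?thesis using mult_left[OF idF_t20[of 0 1 m "n+1"]] by (metis zero_less_one)
      qed
      ultimately show ?thesis by (rule R_cong)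
    qed
  qed
  show ?thesis
  proof (induction x rule: falg_induct)
    case (scal c)
    have "YF s3 (scal c) = fscal c" using alg_homs(1) by (auto simp: alg_hom_def)
    then show ?case by (simp add: c R_scal)
  next
    case (gn j m n)
    then have "j = 0" using letters by fastforce
    then show ?case using gen by (simp add: gn_images)
  next
    case (add x y) then show ?case unfolding y.h_add H.h_add by (rule R_add)
  next
    case (mult x y) then show ?case unfolding y.h_mult H.h_mult by (rule R_mult)
  qed
qed

lemma pairing_kill:
  assumes "alg_hom scal h" "(\<forall>n. h (gn 0 0 n) = 0) \<or> (\<forall>n. h (gn 1 0 n) = 0)"
  shows "h (pairing s3 0 1 K) = 0"
proof -
  interpret h: ring_hom h by (rule alg_hom_ring_hom[OF assms(1)])
  show ?thesis unfolding pairing_def using assms(2)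
    by (auto simp: h.h_sum h.h_mult intro!: sum.neutral) 
qed

lemma counit:
  assumes "\<And>u l. lookup x u \<noteq> 0 \<Longrightarrow> l \<in> set u \<Longrightarrow> fst l = 0"
  shows "cIdF (YF s3 x $$ n) - (if n = 0 then x else 0) \<in> idF s2 s3 1"
proof -
  interpret ideal2 "idF s2 s3 1" by (rule ideal2_idF)
  interpret h: ring_hom cIdF by (rule alg_hom_ring_hom[OF alg_homs(5)])
  \<comment> \<open>Killing the first factor removes the translated term and every interaction, so
    no power of w survives on t_{0,n} and t_{2,0}: the series is congruent to a constant
    one.\<close>
  let ?R = "\<lambda>(f::falg fls) x. \<forall>n. f $$ n - fls_const x $$ n \<in> idF s2 s3 1"
  have "?R (fls_map cIdF (YF s3 x)) x"
  proof (rule DlF_counit[where R = ?R and ?s2.0 = s2 and h = cIdF])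
    fix f g :: "falg fls" and x y
    assume fg: "?R f x" "?R g y"
    show "?R (f + g) (x + y)"
    proof
      fix n
      have "(f + g) $$ n - fls_const (x + y) $$ n = (f $$ n - fls_const x $$ n) + (g $$ n - fls_const y $$ n)"
        by simp
      also have "\<dots> \<in> idF s2 s3 1" using fg by (intro add) auto
      finally show "(f + g) $$ n - fls_const (x + y) $$ n \<in> idF s2 s3 1" .
    qed
    show "?R (f * g) (x * y)"
    proof
      fix n
      have "f * g - fls_const (x * y) = (f - fls_const x) * g + fls_const x * (g - fls_const y)"
        by (simp add: algebra_simps)
      then have "(f * g) $$ n - fls_const (x * y) $$ n =
          ((f - fls_const x) * g) $$ n + (fls_const x * (g - fls_const y)) $$ n"
        by (metis fls_minus_nth fls_plus_nth)
      moreover have "((f - fls_const x) * g) $$ n \<in> idF s2 s3 1"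
        unfolding fls_times_nth(2) using fg by (intro sum mult_right) simp
      moreover have "(fls_const x * (g - fls_const y)) $$ n \<in> idF s2 s3 1"
        using fg by (simp only: fls_mult_const_nth fls_minus_nth mult_left)
      ultimately show "(f * g) $$ n - fls_const (x * y) $$ n \<in> idF s2 s3 1"
        by (simp only: add)
    qed
  next
    fix f :: "falg fls" and x y assume fx: "?R f x" and xy: "x - y \<in> idF s2 s3 1"
    show "?R f y"
    proof
      fix n
      have "f $$ n - fls_const y $$ n = (f $$ n - fls_const x $$ n) + (if n = 0 then x - y else 0)" by simp
      also have "\<dots> \<in> idF s2 s3 1" using fx xy by (intro add) (simp_all add: ideal2.zero[OF ideal2_idF])
      finally show "f $$ n - fls_const y $$ n \<in> idF s2 s3 1" .
    qed
  next
    fix m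
    have "fls_map cIdF (D0F 0 1 m) = fls_const (gn 0 0 m)"
      by (rule fls_eqI) (auto simp: D0F_nth h.h_add h.h_mult gn_images)
    then show "?R (fls_map cIdF (D0F 0 1 m)) (gn 0 0 m)"
      by (simp add: ideal2.zero[OF ideal2_idF])
  next
    have "cIdF (pairing s3 0 1 K) = 0" for K by (rule pairing_kill[OF alg_homs(5)]) (simp add: gn_images)
    then have "fls_map cIdF (D20F s3 0 1) = fls_const (gn 0 2 0)"
      by (intro fls_eqI) (simp add: D20F_pairing h.h_add gn_images)
    then show "?R (fls_map cIdF (D20F s3 0 1)) (gn 0 2 0)"
      by (simp add: ideal2.zero[OF ideal2_idF])
  qed (use assms in \<open>auto intro: alg_homs ideal2.zero[OF ideal2_idF]\<close>)
  then have "fls_map cIdF (YF s3 x) $$ n - fls_const x $$ n \<in> idF s2 s3 1" by blast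
  then show ?thesis by simp
qed

lemma cocreation:
  assumes "\<And>u l. lookup x u \<noteq> 0 \<Longrightarrow> l \<in> set u \<Longrightarrow> fst l = 0"
  shows "(\<forall>n>0. IdcF (YF s3 x $$ n) = 0) \<and> IdcF (YF s3 x $$ 0) - x \<in> idF s2 s3 1"
proof -
  interpret ideal2 "idF s2 s3 1" by (rule ideal2_idF)
  interpret h: ring_hom IdcF by (rule alg_hom_ring_hom[OF alg_homs(6)])
  \<comment> \<open>Killing the second factor leaves (x + w)^n, which is not constant. The relation
    therefore asks for no negative powers of w, exactly, and for the right value at w = 0, modulo
    the ideal.\<close>
  let ?R = "\<lambda>(f::falg fls) x. (\<forall>n>0. f $$ n = 0) \<and> f $$ 0 - x \<in> idF s2 s3 1"
  have "?R (fls_map IdcF (YF s3 x)) x"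
  proof (rule DlF_counit[where R = ?R and ?s2.0 = s2 and h = IdcF])
    fix f g :: "falg fls" and x y
    assume fg: "?R f x" "?R g y"
    have "(f + g) $$ 0 - (x + y) = (f $$ 0 - x) + (g $$ 0 - y)" by simp
    then show "?R (f + g) (x + y)" using fg by (simp only: add) simp
    obtain a b where ab: "\<And>i. i < a \<Longrightarrow> f $$ i = 0" "\<And>i. i < b \<Longrightarrow> g $$ i = 0"
      using fls_bounded_below by metis
    \<comment> \<open>Taking minima with 0 ensures that for \<open>n = 0\<close> the window contains
      the index 0.\<close>
    have s: "(f * g) $$ n = (\<Sum>i=min a 0..n - min b 0. f $$ i * g $$ (n - i))" for n
      by (rule fls_nth_times_bound) (use ab in auto)
    \<comment> \<open>One of the two indices is positive, so that factor vanishes. Hence evaluation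
      at w = 0 is multiplicative.\<close>
    have p: "f $$ i * g $$ (n - i) = 0" if "n \<ge> 0" "n > 0 \<or> i \<noteq> 0" for i n
      using fg that by (cases "i > 0") auto
    have "(f * g) $$ n = 0" if "n > 0" for n
      unfolding s by (rule sum.neutral) (use p that in auto)
    moreover have "(f * g) $$ 0 = f $$ 0 * g $$ 0"
    proof -
      have "(f * g) $$ 0 = (\<Sum>i\<in>{0}. f $$ i * g $$ (0 - i))"
        unfolding s by (rule sum.mono_neutral_right) (use p[of 0] in auto)
      then show ?thesis by simp
    qed
    then have "(f * g) $$ 0 - x * y = (f $$ 0 - x) * g $$ 0 + x * (g $$ 0 - y)"
      by (simp add: algebra_simps)
    then have "(f * g) $$ 0 - x * y \<in> idF s2 s3 1"
      using fg by (simp only: add mult_left mult_right)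
    ultimately show "?R (f * g) (x * y)" by blast
  next
    fix f :: "falg fls" and x y assume fx: "?R f x" and xy: "x - y \<in> idF s2 s3 1"
    have "f $$ 0 - y = (f $$ 0 - x) + (x - y)" by simp
    then show "?R f y" using fx xy by (simp only: add) simp
  next
    fix m
    have "IdcF (scal c) = scal c" for c using alg_homs(6) by (simp add: alg_hom_def)
    then show "?R (fls_map IdcF (D0F 0 1 m)) (gn 0 0 m)"
      by (auto simp: D0F_nth h.h_add h.h_mult gn_images ideal2.zero[OF ideal2_idF])
  next
    have "IdcF (pairing s3 0 1 K) = 0" for K by (rule pairing_kill[OF alg_homs(6)]) (simp add: gn_images)
    then show "?R (fls_map IdcF (D20F s3 0 1)) (gn 0 2 0)"
      by (auto simp: D20F_pairing h.h_add gn_images ideal2.zero[OF ideal2_idF])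
  qed (use assms in \<open>auto intro: alg_homs ideal2.zero[OF ideal2_idF]\<close>)
  then show ?thesis by simp
qed

section \<open>The axioms for the given representative\<close>

theorem theorem1:
  fixes e1 e2 e3 :: complex and v :: fa
  assumes "e1 + e2 + e3 = 0"
    and "finsupp v"
    and "\<forall>u. v u \<noteq> 0 \<longrightarrow> (\<forall>l\<in>set u. fst l = 0)"
  shows "(\<forall>k. eqv (sig2 e1 e2) (sig3 e1 e2 e3) 1
                 (cId (Y (sig3 e1 e2 e3) v k)) (if k = 0 then v else fzero))
       \<and> (\<exists>N. \<forall>k. (k < 0 \<or> k > N) \<longrightarrow>
                 eqv (sig2 e1 e2) (sig3 e1 e2 e3) 1 (Idc (Y (sig3 e1 e2 e3) v k)) fzero)
       \<and> eqv (sig2 e1 e2) (sig3 e1 e2 e3) 1 (Idc (Y (sig3 e1 e2 e3) v 0)) v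
       \<and> (\<forall>i0 i1 i2.
            eqv (sig2 e1 e2) (sig3 e1 e2 e3) 3
              (fminus
                 (J1 (\<lambda>a b. IdY (sig3 e1 e2 e3) (Y (sig3 e1 e2 e3) v a) b) i0 i1 i2)
                 (J2 (\<lambda>a b. Tsw (IdY (sig3 e1 e2 e3) (Y (sig3 e1 e2 e3) v b) a)) i0 i1 i2))
              (J3 (\<lambda>a b. YId (sig3 e1 e2 e3) (Y (sig3 e1 e2 e3) v b) a) i0 i1 i2))"
proof -
  define s2 s3 where "s2 = sig2 e1 e2" and "s3 = sig3 e1 e2 e3"
  obtain x where v: "v = lookup x" using ex_lookup[OF assms(2)] by blast
  have letters: "fst l = 0" if "lookup x u \<noteq> 0" "l \<in> set u" for u l
    using assms(3) that v by blast
  have cu: "cIdF (YF s3 x $$ n) - (if n = 0 then x else 0) \<in> idF s2 s3 1" for n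
    by (rule counit) (rule letters)
  have co: "(\<forall>n>0. IdcF (YF s3 x $$ n) = 0) \<and> IdcF (YF s3 x $$ 0) - x \<in> idF s2 s3 1"
    by (rule cocreation) (rule letters)
  have 1: "eqv s2 s3 1 (cId (Y s3 v k)) (if k = 0 then v else fzero)" for k
  proof -
    have "(if k = 0 then v else fzero) = lookup (if - k = 0 then x else 0)"
      by (simp add: v lookup_0[symmetric])
    then show ?thesis
      using cu[of "- k"] by (simp only: v Y_lookup cId_lookup eqv_lookup)
  qed
  \<comment> \<open>The lower bound for powers of 1 / w gives the degree bound \<open>- a\<close>
    for the polynomial in w.\<close>
  obtain a where a: "\<And>i. i < a \<Longrightarrow> YF s3 x $$ i = 0" using fls_bounded_below by metis
  have 2: "eqv s2 s3 1 (Idc (Y s3 v k)) fzero" if "k < 0 \<or> k > - a" for k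
  proof -
    have "IdcF (YF s3 x $$ (- k)) = 0"
      using that co a[of "- k"] alg_hom_0[OF alg_homs(6)] by auto
    then show ?thesis
      using ideal2.zero[OF ideal2_idF]
      by (simp only: v Y_lookup Idc_lookup lookup_0[symmetric] eqv_lookup diff_0_right)
  qed
  have 3: "eqv s2 s3 1 (Idc (Y s3 v 0)) v"
    using co by (simp only: v Y_lookup Idc_lookup eqv_lookup minus_zero)
  have 4: "eqv s2 s3 3 (fminus (J1 (\<lambda>a b. IdY s3 (Y s3 v a) b) i0 i1 i2)
      (J2 (\<lambda>a b. Tsw (IdY s3 (Y s3 v b) a)) i0 i1 i2)) (J3 (\<lambda>a b. YId s3 (Y s3 v b) a) i0 i1 i2)" for i0 i1 i2
  proof -
    have "(\<lambda>a b. IdY s3 (Y s3 v a) b) = (\<lambda>a b. lookup (phi1 s3 (YF s3 x) $$ (- a) $$ (- b)))"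
      "(\<lambda>a b. Tsw (IdY s3 (Y s3 v b) a)) = (\<lambda>a b. lookup (phi2 s3 (YF s3 x) $$ (- b) $$ (- a)))"
      "(\<lambda>a b. YId s3 (Y s3 v b) a) = (\<lambda>a b. lookup (phi3 s3 (YF s3 x) $$ (- b) $$ (- a)))"
      by (simp_all only: v Y_lookup IdY_lookup YId_lookup Tsw_lookup phi_nth TF_nth)
    then show ?thesis
      using ideal_falg.compat_jacobi[OF ideal_falg_idF compat_YF]
      by (simp only: J1_lookup J2_lookup J3_lookup lookup_diff[symmetric] eqv_lookup)
  qed
  show ?thesis unfolding s2_def[symmetric] s3_def[symmetric] using 1 2 3 4 by blast
qed

end
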